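(* Let $n\ge2$ and $N\in\mathbb{N}\cup\{\infty\}$, and let $f_1,\dots,f_N$ be bounded slice monogenic $\mathbb{R}_n$-valued functions on the open unit ball $\mathbb{B}\subset\mathbb{R}^{n+1}$. Suppose that for some $I\in\mathbb{S}$ the block matrix $\mathsf{F}=(M_{f_1}\ \cdots\ M_{f_N})$, defined on $\mathbb{D}\cong\mathbb{B}\cap\mathbb{C}_I$, admits (via the matrix Corona theorem) a bounded right inverse, i.e. a bounded holomorphic matrix function $\mathsf{P}\in H^\infty(\mathbb{D})^{N\cdot 2^{n-1}\times 2^{n-1}}$ with $\mathsf{F}(z)\mathsf{P}(z)=\mathrm{Id}_{2^{n-1}}$ for all $z\in\mathbb{D}$. Then there exist bounded slice monogenic $\mathbb{R}_n$-valued functions $h_1,\dots,h_N$ on $\mathbb{B}$ satisfying the Bezout identity $$f_1*h_1+\cdots+f_N*h_N=1.$$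
   Context: Clifford algebra: $\mathbb{R}_n$ is the real unital associative algebra generated by $I_1,\dots,I_n$ with $I_iI_j+I_jI_i=-2\delta_{ij}$. For $A=\{a_1<\dots<a_k\}$ write $I_A=I_{a_1}\cdots I_{a_k}$, $I_\emptyset=1$. $(x_0,\dots,x_n)\in\mathbb{R}^{n+1}$ is identified with $x_0+x_1I_1+\dots+x_nI_n$. $\mathbb{S}$ is the set of unit 1-vectors $x_1I_1+\dots+x_nI_n$, $\sum x_i^2=1$; each $I\in\mathbb{S}$ has $I^2=-1$, and $\mathbb{C}_I=\mathbb{R}+I\mathbb{R}\cong\mathbb{C}$. Slice monogenic functions: a real-differentiable $f:U\to\mathbb{R}_n$, $U\subseteq\mathbb{R}^{n+1}$ open, is (left) slice monogenic if for every $I\in\mathbb{S}$ the restriction $f_I=f|_{U\cap\mathbb{C}_I}$ satisfies $\frac12(\partial_u+I\partial_v)f_I(u+Iv)=0$. Splitting: given $I\in\mathbb{S}$, set $I_1=I$ and complete to unit 1-vectors $I_1,I_2,\dots,I_n$ generating $\mathbb{R}_n$ with $I_iI_j+I_jI_i=-2\delta_{ij}$. Let $\mathcal{I}$ be the set of all subsets of $\{2,\dots,n\}$ (so $|\mathcal{I}|=2^{n-1}$). Every slice monogenic $f$ has $f_I(z)=\sum_{A\in\mathcal{I}}F_A(z)I_A$ with unique holomorphic $F_A:U\cap\mathbb{C}_I\to\mathbb{C}_I$. For holomorphic $G$ put $\hat G(z)=\overline{G(\bar z)}$. Sign: $\sigma(A,B)=|A\cap B|+|\{(a,b)\in A\times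 B: a>b\}|$, and $A\triangle B$ is the symmetric difference. Slice product: for $f_I=\sum_A F_AI_A$, $g_I=\sum_B G_BI_B$, $$f_I*g_I=\sum_{C\in\mathcal{I}}\Big(\sum_{A\triangle B=C}(-1)^{\sigma(A,B)}F_A\,\widetilde G_B\Big)I_C,$$ where $\widetilde G_B=G_B$ if $|A|$ is even and $\widetilde G_B=\hat G_B$ if $|A|$ is odd. $f*g$ is the unique slice monogenic extension of $f_I*g_I$ to $\mathbb{B}$. Matrix $M_f$: the $2^{n-1}\times 2^{n-1}$ matrix indexed by $\mathcal{I}\times\mathcal{I}$ with $(M_f)_{A,B}=(-1)^{\sigma(A\triangle B,B)}F_{A\triangle B}$ if $|A|$ is even and $(M_f)_{A,B}=(-1)^{\sigma(A\triangle B,B)}\hat F_{A\triangle B}$ if $|A|$ is odd. For $N=\infty$ the matrix $\mathsf{F}$ has countably many blocks, and matrix products and the Bezout sum are infinite sums over $j$. *)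

theory Defs
  imports "HOL-Analysis.Analysis" "HOL-Library.Extended_Nat"
begin

section \<open>The Clifford algebra\<close>

text \<open>
  The algebra on \<open>n = CARD('n)\<close> generators is modelled by its coefficients with respect to the
  basis \<open>I_A\<close>, where \<open>A\<close> ranges over the subsets of \<open>{1..n}\<close>.  The type \<open>'n\<close> serves only to
  carry the number \<open>n\<close>.
\<close>

typedef 'n clifford = "{x :: nat set \<Rightarrow> real. \<forall>A. \<not> A \<subseteq> {1..CARD('n)} \<longrightarrow> x A = 0}"
  morphisms coeff Abs_clifford
  by (rule exI[of _ "\<lambda>_. 0"]) simp

definition mk_clifford :: "(nat set \<Rightarrow> real) \<Rightarrow> 'n clifford" where
  "mk_clifford x = Abs_clifford (\<lambda>A. if A \<subseteq> {1..CARD('n)} then x A else 0)"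

lemma coeff_mk [simp]:
  "coeff (mk_clifford x :: 'n clifford) A = (if A \<subseteq> {1..CARD('n)} then x A else 0)"
  unfolding mk_clifford_def by (subst Abs_clifford_inverse) auto

lemma coeff_outside: "\<not> A \<subseteq> {1..CARD('n)} \<Longrightarrow> coeff (x :: 'n clifford) A = 0"
  using coeff[of x] by auto

lemma clifford_eqI:
  assumes "\<And>A. A \<subseteq> {1..CARD('n)} \<Longrightarrow> coeff x A = coeff y A"
  shows "(x :: 'n clifford) = y"
proof -
  have "coeff x A = coeff y A" for A
    using assms coeff_outside[of A x] coeff_outside[of A y] by (cases "A \<subseteq> {1..CARD('n)}") auto
  then show ?thesis by (metis coeff_inject ext)
qed

text \<open>The sign exponent in \<open>I_A I_B = (-1)^\<sigma>(A,B) I_(A \<triangle> B)\<close>.\<close>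

definition sgn_exp :: "nat set \<Rightarrow> nat set \<Rightarrow> nat" (\<open>\<sigma>\<close>) where
  "\<sigma> A B = card (A \<inter> B) + card {(a, b) \<in> A \<times> B. a > b}"

lemma sgn_exp_prod:
  assumes "finite A" "finite B"
  shows "(-1 :: 'a :: comm_ring_1) ^ \<sigma> A B = (\<Prod>a\<in>A. \<Prod>b\<in>B. if b \<le> a then -1 else 1)"
proof -
  have "card (A \<inter> B) = card {(a, b) \<in> A \<times> B. a = b}"
    by (rule bij_betw_same_card[of "\<lambda>a. (a, a)"]) (auto simp: bij_betw_def inj_on_def)
  moreover have "card {(a, b) \<in> A \<times> B. a = b} + card {(a, b) \<in> A \<times> B. a > b} =
      card ({(a, b) \<in> A \<times> B. a = b} \<union> {(a, b) \<in> A \<times> B. a > b})"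
    by (rule card_Un_disjoint[symmetric])
      (auto intro: finite_subset[of _ "A \<times> B"] simp: assms)
  moreover have "{(a, b) \<in> A \<times> B. a = b} \<union> {(a, b) \<in> A \<times> B. a > b} =
      {p \<in> A \<times> B. snd p \<le> fst p}" by auto
  ultimately have *: "\<sigma> A B = card {p \<in> A \<times> B. snd p \<le> fst p}"
    by (simp add: sgn_exp_def)
  have "(\<Prod>a\<in>A. \<Prod>b\<in>B. if b \<le> a then -1 else 1 :: 'a) =
      (\<Prod>p\<in>A \<times> B. if snd p \<le> fst p then -1 else 1)"
    by (simp add: prod.cartesian_product case_prod_unfold)
  also have "\<dots> = (\<Prod>p\<in>{p \<in> A \<times> B. snd p \<le> fst p}. -1)"
    using assms by (intro prod.mono_neutral_cong_right) auto
  also have "\<dots> = (-1) ^ \<sigma> A B" by (simp add: *)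
  finally show ?thesis by simp
qed

lemma prod_sym_diff:
  fixes g :: "'b \<Rightarrow> 'a :: comm_ring_1"
  assumes "finite A" "finite B" "\<And>x. g x * g x = 1"
  shows "prod g (sym_diff A B) = prod g A * prod g B"
proof -
  have "prod g (sym_diff A B) = prod g (A - B) * prod g (B - A)"
    using assms by (intro prod.union_disjoint) auto
  also have "\<dots> = prod g (A - B) * prod g (B - A) * (\<Prod>x\<in>A \<inter> B. g x * g x)"
    by (simp add: assms(3))
  also have "\<dots> = (prod g (A - B) * prod g (A \<inter> B)) * (prod g (B - A) * prod g (B \<inter> A))"
    by (simp add: prod.distrib algebra_simps Int_commute)
  also have "\<dots> = prod g ((A - B) \<union> (A \<inter> B)) * prod g ((B - A) \<union> (B \<inter> A))"
    using assms by (subst (1 2) prod.union_disjoint) auto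
  finally show ?thesis by (simp add: Un_Diff_Int)
qed

lemma sgn_exp_sym_diff_left:
  assumes "finite A" "finite B" "finite C"
  shows "(-1 :: 'a :: comm_ring_1) ^ \<sigma> (sym_diff A B) C = (-1) ^ \<sigma> A C * (-1) ^ \<sigma> B C"
proof -
  have "(\<Prod>c\<in>C. if c \<le> x then - 1 else 1 :: 'a) * (\<Prod>c\<in>C. if c \<le> x then - 1 else 1) = 1" for x
    unfolding prod.distrib[symmetric] by (rule prod.neutral) simp
  then show ?thesis
    using assms by (subst (1 2 3) sgn_exp_prod) (simp_all add: prod_sym_diff)
qed

lemma sgn_exp_sym_diff_right:
  assumes "finite A" "finite B" "finite C"
  shows "(-1 :: 'a :: comm_ring_1) ^ \<sigma> C (sym_diff A B) = (-1) ^ \<sigma> C A * (-1) ^ \<sigma> C B"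
proof -
  have "(\<Prod>b\<in>sym_diff A B. if b \<le> c then - 1 else 1 :: 'a) =
     (\<Prod>b\<in>A. if b \<le> c then - 1 else 1) * (\<Prod>b\<in>B. if b \<le> c then - 1 else 1)" for c
    using assms by (intro prod_sym_diff) auto
  then show ?thesis
    using assms by (subst (1 2 3) sgn_exp_prod) (simp_all add: prod.distrib[symmetric])
qed

instantiation clifford :: (type) ab_group_add
begin
definition "0 = (mk_clifford (\<lambda>_. 0) :: 'a clifford)"
definition "x + y = (mk_clifford (\<lambda>A. coeff x A + coeff y A) :: 'a clifford)"
definition "- x = (mk_clifford (\<lambda>A. - coeff x A) :: 'a clifford)"
definition "x - y = (mk_clifford (\<lambda>A. coeff x A - coeff y A) :: 'a clifford)"
instance
  by standard
    (auto intro!: clifford_eqI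
      simp: zero_clifford_def plus_clifford_def uminus_clifford_def minus_clifford_def)
end

lemma coeff_zero [simp]: "coeff 0 A = 0"
  by (simp add: zero_clifford_def)
lemma coeff_add [simp]: "coeff (x + y) A = coeff x A + coeff y A"
  by (simp add: plus_clifford_def coeff_outside)
lemma coeff_uminus [simp]: "coeff (- x) A = - coeff x A"
  by (simp add: uminus_clifford_def coeff_outside)
lemma coeff_diff [simp]: "coeff (x - y) A = coeff x A - coeff y A"
  by (simp add: minus_clifford_def coeff_outside)
lemma coeff_sum [simp]: "coeff (sum f S) A = (\<Sum>i\<in>S. coeff (f i) A)"
  by (induction S rule: infinite_finite_induct) auto

instantiation clifford :: (type) real_vector
begin
definition "r *\<^sub>R x = (mk_clifford (\<lambda>A. r * coeff x A) :: 'a clifford)"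
instance
  by standard (auto intro!: clifford_eqI simp: scaleR_clifford_def algebra_simps)
end

lemma coeff_scaleR [simp]: "coeff (r *\<^sub>R x) A = r * coeff x A"
  by (simp add: scaleR_clifford_def coeff_outside)

definition blade :: "nat set \<Rightarrow> 'n clifford" where
  "blade A = mk_clifford (\<lambda>B. if B = A then 1 else 0)"

instantiation clifford :: (type) "{one, times}"
begin
definition "1 = (blade {} :: 'a clifford)"
definition "x * y = (mk_clifford (\<lambda>C.
    \<Sum>(A, B) \<in> {(A, B). A \<subseteq> {1..CARD('a)} \<and> B \<subseteq> {1..CARD('a)} \<and> sym_diff A B = C}.
      (-1) ^ \<sigma> A B * coeff x A * coeff y B) :: 'a clifford)"
instance ..
end

lemma coeff_one: "coeff 1 A = (if A = {} then 1 else 0)"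
  by (simp add: one_clifford_def blade_def)

lemma sym_diff_cancel: "sym_diff A (sym_diff A B) = B" by blast

lemma sym_diff_assoc: "sym_diff (sym_diff A B) C = sym_diff A (sym_diff B C)" by blast

lemma sym_diff_sub: "A \<subseteq> S \<Longrightarrow> B \<subseteq> S \<Longrightarrow> sym_diff A B \<subseteq> S" by blast

lemma coeff_mult:
  fixes x y :: "'n clifford"
  assumes "C \<subseteq> {1..CARD('n)}"
  shows "coeff (x * y) C = (\<Sum>A\<in>Pow {1..CARD('n)}.
           (-1) ^ \<sigma> A (sym_diff A C) * coeff x A * coeff y (sym_diff A C))"
proof -
  have "coeff (x * y) C =
     (\<Sum>p \<in> {(A, B). A \<subseteq> {1..CARD('n)} \<and> B \<subseteq> {1..CARD('n)} \<and> sym_diff A B = C}.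
      (-1) ^ \<sigma> (fst p) (snd p) * coeff x (fst p) * coeff y (snd p))"
    using assms by (simp add: times_clifford_def case_prod_unfold)
  also have "\<dots> = (\<Sum>A\<in>Pow {1..CARD('n)}.
           (-1) ^ \<sigma> A (sym_diff A C) * coeff x A * coeff y (sym_diff A C))"
    by (rule sum.reindex_bij_witness[of _ "\<lambda>A. (A, sym_diff A C)" fst])
      (use assms in \<open>auto simp: sym_diff_cancel\<close>)
  finally show ?thesis .
qed

lemma coeff_mult_blade_left:
  fixes y :: "'n clifford"
  assumes "A \<subseteq> {1..CARD('n)}" "C \<subseteq> {1..CARD('n)}"
  shows "coeff (blade A * y) C = (-1) ^ \<sigma> A (sym_diff A C) * coeff y (sym_diff A C)"
proof -
  have "coeff (blade A * y) C = (\<Sum>A'\<in>Pow {1..CARD('n)}.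
      if A' = A then (-1) ^ \<sigma> A (sym_diff A C) * coeff y (sym_diff A C) else 0)"
    using assms by (subst coeff_mult[OF assms(2)], intro sum.cong) (auto simp: blade_def)
  also have "\<dots> = (-1) ^ \<sigma> A (sym_diff A C) * coeff y (sym_diff A C)"
    using assms by (subst sum.delta) auto
  finally show ?thesis .
qed

lemma blade_mult:
  assumes "A \<subseteq> {1..CARD('n)}" "B \<subseteq> {1..CARD('n)}"
  shows "(blade A * blade B :: 'n clifford) = (-1) ^ \<sigma> A B *\<^sub>R blade (sym_diff A B)"
proof (rule clifford_eqI)
  fix C assume C: "C \<subseteq> {1..CARD('n)}"
  have "sym_diff A C = B \<longleftrightarrow> C = sym_diff A B" by blast
  moreover have "sym_diff A C \<subseteq> {1..CARD('n)}" using C assms by blast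
  ultimately show "coeff (blade A * blade B :: 'n clifford) C =
      coeff ((-1) ^ \<sigma> A B *\<^sub>R blade (sym_diff A B) :: 'n clifford) C"
    using C assms
    by (subst coeff_mult_blade_left) (simp_all add: blade_def sym_diff_cancel del: Un_subset_iff)
qed

instance clifford :: (type) real_algebra_1
proof
  fix x y z :: "'a clifford" and r :: real
  let ?N = "{1..CARD('a)}"
  have fin: "finite A" if "A \<subseteq> ?N" for A using that finite_subset by blast
  show "x * y * z = x * (y * z)"
  proof (rule clifford_eqI)
    fix D assume D: "D \<subseteq> ?N"
    have "coeff (x * y * z) D = (\<Sum>C\<in>Pow ?N. \<Sum>A\<in>Pow ?N.
        (-1) ^ \<sigma> C (sym_diff C D) * ((-1) ^ \<sigma> A (sym_diff A C) * coeff x A * coeff y (sym_diff A C))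
          * coeff z (sym_diff C D))"
      by (subst coeff_mult[OF D])
        (auto simp: coeff_mult sum_distrib_left sum_distrib_right intro!: sum.cong)
    also have "\<dots> = (\<Sum>A\<in>Pow ?N. \<Sum>C\<in>Pow ?N.
        (-1) ^ \<sigma> C (sym_diff C D) * ((-1) ^ \<sigma> A (sym_diff A C) * coeff x A * coeff y (sym_diff A C))
          * coeff z (sym_diff C D))"
      by (rule sum.swap)
    also have "\<dots> = (\<Sum>A\<in>Pow ?N. \<Sum>B\<in>Pow ?N.
        (-1) ^ \<sigma> A (sym_diff A D) * coeff x A *
          ((-1) ^ \<sigma> B (sym_diff B (sym_diff A D)) * coeff y B * coeff z (sym_diff B (sym_diff A D))))"
    proof (rule sum.cong[OF refl])
      fix A assume A: "A \<in> Pow ?N"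
      show "(\<Sum>C\<in>Pow ?N.
        (-1) ^ \<sigma> C (sym_diff C D) * ((-1) ^ \<sigma> A (sym_diff A C) * coeff x A * coeff y (sym_diff A C))
          * coeff z (sym_diff C D)) = (\<Sum>B\<in>Pow ?N.
        (-1) ^ \<sigma> A (sym_diff A D) * coeff x A *
          ((-1) ^ \<sigma> B (sym_diff B (sym_diff A D)) * coeff y B * coeff z (sym_diff B (sym_diff A D))))"
      proof (rule sum.reindex_bij_witness[of _ "sym_diff A" "sym_diff A"])
        fix C assume C: "C \<in> Pow ?N"
        define B where "B = sym_diff A C"
        define E where "E = sym_diff C D"
        have CB: "C = sym_diff A B" unfolding B_def by blast
        have BE: "sym_diff B (sym_diff A D) = E" unfolding B_def E_def by blast
        have AD: "sym_diff A D = sym_diff B E" unfolding B_def E_def by blast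
        have f: "finite A" "finite B" "finite E"
          using A C D by (auto simp: B_def E_def intro!: fin)
        have 1: "(-1 :: real) ^ \<sigma> C E = (-1) ^ \<sigma> A E * (-1) ^ \<sigma> B E"
          unfolding CB by (rule sgn_exp_sym_diff_left) (fact f)+
        have 2: "(-1 :: real) ^ \<sigma> A (sym_diff A D) = (-1) ^ \<sigma> A B * (-1) ^ \<sigma> A E"
          unfolding AD by (rule sgn_exp_sym_diff_right) (fact f)+
        show "(-1) ^ \<sigma> A (sym_diff A D) * coeff x A * ((-1) ^ \<sigma> (sym_diff A C)
            (sym_diff (sym_diff A C) (sym_diff A D)) * coeff y (sym_diff A C) *
            coeff z (sym_diff (sym_diff A C) (sym_diff A D))) =
          (-1) ^ \<sigma> C (sym_diff C D) * ((-1) ^ \<sigma> A (sym_diff A C) * coeff x A *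
            coeff y (sym_diff A C)) * coeff z (sym_diff C D)"
          unfolding B_def[symmetric] E_def[symmetric] BE 1 2 by (simp add: algebra_simps)
      qed (use A in \<open>auto simp: sym_diff_cancel\<close>)
    qed
    also have "\<dots> = coeff (x * (y * z)) D"
    proof -
      have "sym_diff A D \<subseteq> ?N" if "A \<in> Pow ?N" for A using that D by blast
      then show ?thesis
        by (subst coeff_mult[OF D])
          (auto simp: coeff_mult sum_distrib_left sum_distrib_right simp del: Un_subset_iff
            intro!: sum.cong)
    qed
    finally show "coeff (x * y * z) D = coeff (x * (y * z)) D" .
  qed
  show "(x + y) * z = x * z + y * z" "x * (y + z) = x * y + x * z"
    "r *\<^sub>R x * y = r *\<^sub>R (x * y)" "x * r *\<^sub>R y = r *\<^sub>R (x * y)"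
    by (auto intro!: clifford_eqI sum.cong
      simp: coeff_mult sum.distrib[symmetric] sum_distrib_left algebra_simps)
  show "1 * x = x"
    unfolding one_clifford_def
    by (rule clifford_eqI, subst coeff_mult_blade_left) (auto simp: sgn_exp_def)
  show "x * 1 = x"
  proof (rule clifford_eqI)
    fix C assume C: "C \<subseteq> ?N"
    have "coeff (x * 1) C = (\<Sum>A\<in>Pow ?N. if A = C then coeff x C else 0)"
    proof (subst coeff_mult[OF C], rule sum.cong[OF refl])
      fix A
      have "sym_diff A C = {} \<longleftrightarrow> A = C" by blast
      then show "(-1) ^ \<sigma> A (sym_diff A C) * coeff x A * coeff 1 (sym_diff A C) =
          (if A = C then coeff x C else 0)"
        by (simp add: coeff_one sgn_exp_def del: Un_empty)
    qed
    then show "coeff (x * 1) C = coeff x C" using C by (subst (asm) sum.delta) auto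
  qed
  show "(0 :: 'a clifford) \<noteq> 1"
    using coeff_one[of "{}", where 'a = 'a] coeff_zero[of "{}", where 'a = 'a] by (metis zero_neq_one)
qed

instantiation clifford :: (type) real_inner
begin
definition inner_clifford :: "'a clifford \<Rightarrow> 'a clifford \<Rightarrow> real" where
  "inner_clifford x y = (\<Sum>A\<in>Pow {1..CARD('a)}. coeff x A * coeff y A)"
definition norm_clifford :: "'a clifford \<Rightarrow> real" where
  "norm_clifford x = sqrt (inner x x)"
definition sgn_clifford :: "'a clifford \<Rightarrow> 'a clifford" where
  "sgn_clifford x = x /\<^sub>R norm x"
definition dist_clifford :: "'a clifford \<Rightarrow> 'a clifford \<Rightarrow> real" where
  "dist_clifford x y = norm (x - y)"
definition uniformity_clifford :: "('a clifford \<times> 'a clifford) filter" where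
  "uniformity_clifford = (INF e\<in>{0<..}. principal {(x, y). dist x y < e})"
definition open_clifford :: "'a clifford set \<Rightarrow> bool" where
  "open_clifford U \<longleftrightarrow> (\<forall>x\<in>U. eventually (\<lambda>(x', y). x' = x \<longrightarrow> y \<in> U) uniformity)"
instance
proof
  fix x y z :: "'a clifford" and r :: real
  show "inner x x = 0 \<longleftrightarrow> x = 0"
    by (auto simp: inner_clifford_def sum_nonneg_eq_0_iff intro!: clifford_eqI)
qed (auto simp: inner_clifford_def norm_clifford_def sgn_clifford_def dist_clifford_def
    uniformity_clifford_def open_clifford_def algebra_simps sum.distrib sum_distrib_left
    intro!: sum_nonneg)
end

instantiation clifford :: (type) euclidean_space
begin
definition Basis_clifford :: "'a clifford set" where
  "Basis_clifford = blade ` Pow {1..CARD('a)}"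
instance
proof
  have 1: "inner x (blade A) = coeff x A" if "A \<subseteq> {1..CARD('a)}" for A and x :: "'a clifford"
  proof -
    have "inner x (blade A) = (\<Sum>B\<in>Pow {1..CARD('a)}. if B = A then coeff x A else 0)"
      unfolding inner_clifford_def by (rule sum.cong) (auto simp: blade_def)
    then show ?thesis using that by (subst (asm) sum.delta) auto
  qed
  fix u v :: "'a clifford"
  show "(\<forall>b\<in>Basis. inner u b = 0) \<longleftrightarrow> u = 0"
    by (auto simp: Basis_clifford_def 1 intro!: clifford_eqI)
  assume "u \<in> Basis" "v \<in> Basis"
  then obtain A B where *: "A \<subseteq> {1..CARD('a)}" "B \<subseteq> {1..CARD('a)}" "u = blade A" "v = blade B"
    by (auto simp: Basis_clifford_def)
  have "blade A = (blade B :: 'a clifford) \<longleftrightarrow> A = B"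
  proof
    assume "blade A = (blade B :: 'a clifford)"
    then have "coeff (blade A :: 'a clifford) A = coeff (blade B :: 'a clifford) A" by simp
    then show "A = B" using * by (simp add: blade_def split: if_splits)
  qed simp
  then show "inner u v = (if u = v then 1 else 0)"
    using * by (simp add: 1) (auto simp: blade_def)
qed (auto simp: Basis_clifford_def)
end

definition gen :: "nat \<Rightarrow> 'n clifford" where
  "gen i = blade {i}"

text \<open>\<open>e_(a_1) \<cdots> e_(a_k)\<close> for \<open>A = {a_1 < \<dots> < a_k}\<close>; the empty product is \<open>1\<close>.\<close>

definition ordered_prod :: "(nat \<Rightarrow> 'a :: monoid_mult) \<Rightarrow> nat set \<Rightarrow> 'a" where
  "ordered_prod e A = prod_list (map e (sorted_list_of_set A))"

definition generates_algebra :: "'a :: real_algebra_1 set \<Rightarrow> bool" where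
  "generates_algebra G \<longleftrightarrow>
     (\<forall>S. subspace S \<and> 1 \<in> S \<and> (\<forall>x\<in>S. \<forall>y\<in>S. x * y \<in> S) \<and> G \<subseteq> S \<longrightarrow> S = UNIV)"

text \<open>
  The next four lemmas identify the type with the algebra generated by \<open>I_1, \<dots>, I_n\<close> subject to
  \<open>I_i I_j + I_j I_i = -2 \<delta>_ij\<close>: the relations hold, \<open>blade A\<close> is the ordered product \<open>I_A\<close>, the
  generators generate, and the dimension is \<open>2^n\<close>.
\<close>

lemma gen_relations:
  assumes "i \<in> {1..CARD('n)}" "j \<in> {1..CARD('n)}"
  shows "gen i * gen j + gen j * gen i = (if i = j then -2 else 0 :: 'n clifford)"
proof (cases "i = j")
  case True
  have *: "{(a, b) \<in> {j} \<times> {j}. b < a} = {}" by auto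
  have "\<sigma> {j} {j} = 1" unfolding sgn_exp_def * by simp
  then show ?thesis
    using assms True by (simp add: gen_def blade_mult one_clifford_def[symmetric])
next
  case False
  have *: "{(a, b) \<in> {i} \<times> {j}. b < a} = (if j < i then {(i, j)} else {})"
    "{(a, b) \<in> {j} \<times> {i}. b < a} = (if i < j then {(j, i)} else {})" by auto
  have "sym_diff {i} {j} = {i, j}" "sym_diff {j} {i} = {i, j}" using False by auto
  moreover have "\<sigma> {i} {j} = (if j < i then 1 else 0)" "\<sigma> {j} {i} = (if i < j then 1 else 0)"
    unfolding sgn_exp_def * using False by auto
  ultimately show ?thesis
    using assms False by (cases "i < j") (simp_all add: gen_def blade_mult)
qed

lemma blade_eq_ordered_prod:
  assumes "A \<subseteq> {1..CARD('n)}"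
  shows "blade A = (ordered_prod gen A :: 'n clifford)"
proof -
  have "blade (set xs) = (prod_list (map gen xs) :: 'n clifford)"
    if "sorted xs" "distinct xs" "set xs \<subseteq> {1..CARD('n)}" for xs
    using that
  proof (induction xs)
    case Nil
    then show ?case by (simp add: one_clifford_def)
  next
    case (Cons x xs)
    have "sym_diff {x} (set xs) = set (x # xs)" using Cons.prems by auto
    moreover have "\<sigma> {x} (set xs) = 0"
      using Cons.prems by (auto simp: sgn_exp_def intro!: card_eq_0_iff[THEN iffD2])
    ultimately have "gen x * blade (set xs) = (blade (set (x # xs)) :: 'n clifford)"
      using Cons.prems by (simp add: gen_def blade_mult)
    then show ?case using Cons by simp
  qed
  from this[of "sorted_list_of_set A"] show ?thesis
    using assms finite_subset[OF assms] by (simp add: ordered_prod_def)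
qed

lemma generates_algebra_gen: "generates_algebra (gen ` {1..CARD('n)} :: 'n clifford set)"
  unfolding generates_algebra_def
proof (intro allI impI)
  fix S :: "'n clifford set"
  assume S: "subspace S \<and> 1 \<in> S \<and> (\<forall>x\<in>S. \<forall>y\<in>S. x * y \<in> S) \<and> gen ` {1..CARD('n)} \<subseteq> S"
  have "prod_list (map gen xs) \<in> S" if "set xs \<subseteq> {1..CARD('n)}" for xs
    using that
  proof (induction xs)
    case (Cons x xs)
    then have "gen x \<in> S" "prod_list (map gen xs) \<in> S" using S by auto
    then show ?case using S by simp
  qed (use S in simp)
  then have "blade A \<in> S" if "A \<subseteq> {1..CARD('n)}" for A
    using that finite_subset[OF that] by (simp add: blade_eq_ordered_prod ordered_prod_def)
  then have "Basis \<subseteq> S" by (auto simp: Basis_clifford_def)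
  then show "S = UNIV" using S span_Basis span_minimal by blast
qed

lemma DIM_clifford: "DIM('n clifford) = 2 ^ CARD('n)"
proof -
  have "inj_on (blade :: _ \<Rightarrow> 'n clifford) (Pow {1..CARD('n)})"
  proof (rule inj_onI)
    fix A B assume *: "A \<in> Pow {1..CARD('n)}" "B \<in> Pow {1..CARD('n)}"
      and "blade A = (blade B :: 'n clifford)"
    then have "coeff (blade A :: 'n clifford) A = coeff (blade B :: 'n clifford) A" by simp
    then show "A = B" using * by (simp add: blade_def split: if_splits)
  qed
  then show ?thesis by (simp add: Basis_clifford_def card_image card_Pow)
qed


section \<open>Slice monogenic functions\<close>

definition unit_vectors :: "'n clifford set" (\<open>\<S>\<close>) where
  "\<S> = {(\<Sum>i=1..CARD('n). x i *\<^sub>R gen i) | x. (\<Sum>i=1..CARD('n). (x i)\<^sup>2) = 1}"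

definition paravectors :: "'n clifford set" where
  "paravectors = {of_real (x 0) + (\<Sum>i=1..CARD('n). x i *\<^sub>R gen i) | x. True}"

definition para_ball :: "'n clifford set" (\<open>\<B>\<close>) where
  "\<B> = paravectors \<inter> ball 0 1"

definition slice_embed :: "'n clifford \<Rightarrow> complex \<Rightarrow> 'n clifford" where
  "slice_embed I z = of_real (Re z) + Im z *\<^sub>R I"

lemma norm_paravector:
  "(norm (of_real a + (\<Sum>i=1..CARD('n). x i *\<^sub>R gen i) :: 'n clifford))\<^sup>2 =
    a\<^sup>2 + (\<Sum>i=1..CARD('n). (x i)\<^sup>2)"
proof -
  let ?v = "\<Sum>i=1..CARD('n). x i *\<^sub>R gen i :: 'n clifford"
  have *: "inner (blade A) (blade B :: 'n clifford) = (if A = B then 1 else 0)"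
    if "A \<subseteq> {1..CARD('n)}" "B \<subseteq> {1..CARD('n)}" for A B
  proof -
    have "inner (blade A) (blade B :: 'n clifford) =
        (\<Sum>C\<in>Pow {1..CARD('n)}. if C = A then (if A = B then 1 else 0) else 0)"
      unfolding inner_clifford_def by (rule sum.cong) (auto simp: blade_def)
    then show ?thesis using that by (subst (asm) sum.delta) auto
  qed
  have 1: "inner 1 ?v = 0"
    unfolding one_clifford_def gen_def inner_sum_right
    by (rule sum.neutral) (auto simp: *)
  have "inner ?v ?v = (\<Sum>i=1..CARD('n). \<Sum>j=1..CARD('n). if j = i then (x i)\<^sup>2 else 0)"
    unfolding inner_sum_left inner_sum_right gen_def
    by (intro sum.cong) (auto simp: * power2_eq_square)
  also have "\<dots> = (\<Sum>i=1..CARD('n). (x i)\<^sup>2)"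
    by (rule sum.cong) (auto simp: sum.delta)
  finally have 2: "inner ?v ?v = (\<Sum>i=1..CARD('n). (x i)\<^sup>2)" .
  have 3: "inner 1 (1 :: 'n clifford) = 1"
    unfolding one_clifford_def by (simp add: *)
  show ?thesis
    unfolding power2_norm_eq_inner of_real_def
    by (simp only: inner_add_left inner_add_right inner_scaleR_left inner_scaleR_right
        inner_commute[of ?v 1] 1 2 3) (simp add: power2_eq_square)
qed

lemma slice_embed_disc:
  assumes "(I :: 'n clifford) \<in> \<S>"
  shows "slice_embed I ` ball 0 1 = \<B> \<inter> range (slice_embed I)"
proof -
  obtain x where I: "I = (\<Sum>i=1..CARD('n). x i *\<^sub>R gen i)" and x: "(\<Sum>i=1..CARD('n). (x i)\<^sup>2) = 1"
    using assms by (auto simp: unit_vectors_def)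
  have e: "slice_embed I z = of_real (Re z) + (\<Sum>i=1..CARD('n). (Im z * x i) *\<^sub>R gen i)" for z
    by (simp add: slice_embed_def I scaleR_sum_right)
  have "(norm (slice_embed I z))\<^sup>2 = (norm z)\<^sup>2" for z
    unfolding e norm_paravector
    by (simp add: power_mult_distrib sum_distrib_left[symmetric] x[simplified] cmod_power2)
  then have n: "norm (slice_embed I z) = norm z" for z
    by (metis norm_ge_zero power2_eq_iff_nonneg)
  have p: "slice_embed I z \<in> paravectors" for z
  proof -
    let ?y = "\<lambda>i. if i = 0 then Re z else Im z * x i"
    have "slice_embed I z = of_real (?y 0) + (\<Sum>i=1..CARD('n). ?y i *\<^sub>R gen i)"
      unfolding e by (intro arg_cong2[of _ _ _ _ "(+)"] sum.cong) auto
    then show ?thesis unfolding paravectors_def by (intro CollectI exI[of _ ?y] conjI TrueI)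
  qed
  show ?thesis using n p by (auto simp: para_ball_def)
qed

text \<open>
  The domain \<open>U\<close> is open in the space of paravectors, so differentiability within \<open>U\<close> is real
  differentiability in the \<open>n + 1\<close> real coordinates; in particular both partial derivatives below
  exist.
\<close>

definition slice_monogenic_on :: "('n clifford \<Rightarrow> 'n clifford) \<Rightarrow> 'n clifford set \<Rightarrow> bool" where
  "slice_monogenic_on f U \<longleftrightarrow>
     openin (top_of_set paravectors) U \<and>
     f differentiable_on U \<and>
     (\<forall>I\<in>\<S>. \<forall>u v. of_real u + v *\<^sub>R I \<in> U \<longrightarrow>
        (1 / 2) *\<^sub>R (vector_derivative (\<lambda>s. f (of_real s + v *\<^sub>R I)) (at u) +
                  I * vector_derivative (\<lambda>t. f (of_real u + t *\<^sub>R I)) (at v)) = 0)"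


section \<open>Splitting, slice product and the matrix of a function\<close>

text \<open>
  A completion of \<open>I\<close> to unit 1-vectors \<open>e 1 = I, e 2, \<dots>, e n\<close> satisfying the defining relations.
  Everything below is formed with respect to such a family \<open>e\<close>; the slice is that of \<open>I = e 1\<close>, and
  its unit disc is identified with the unit disc of the complex numbers.
\<close>

definition splitting_frame :: "'n clifford \<Rightarrow> (nat \<Rightarrow> 'n clifford) \<Rightarrow> bool" where
  "splitting_frame I e \<longleftrightarrow>
     e 1 = I \<and>
     e ` {1..CARD('n)} \<subseteq> \<S> \<and>
     generates_algebra (e ` {1..CARD('n)}) \<and>
     (\<forall>i\<in>{1..CARD('n)}. \<forall>j\<in>{1..CARD('n)}. e i * e j + e j * e i = (if i = j then -2 else 0))"

lemma splitting_frame_gen: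
  assumes "CARD('n) \<ge> 1"
  shows "splitting_frame (gen 1) (gen :: nat \<Rightarrow> 'n clifford)"
proof -
  have "(gen i :: 'n clifford) \<in> \<S>" if "i \<in> {1..CARD('n)}" for i
  proof -
    have "(\<Sum>j=1..CARD('n). (if j = i then 1 else 0) *\<^sub>R gen j) =
        (\<Sum>j=1..CARD('n). if j = i then gen i else (0 :: 'n clifford))"
      by (rule sum.cong) auto
    also have "\<dots> = gen i" using that by (subst sum.delta) auto
    finally have 1: "gen i = (\<Sum>j=1..CARD('n). (if j = i then 1 else 0) *\<^sub>R gen j :: 'n clifford)"
      by simp
    have "(\<Sum>j=1..CARD('n). (if j = i then 1 else 0 :: real)\<^sup>2) =
        (\<Sum>j=1..CARD('n). if j = i then 1 else 0)"
      by (rule sum.cong) auto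
    also have "\<dots> = 1" using that by (subst sum.delta) auto
    finally show ?thesis using 1 unfolding unit_vectors_def
      by (intro CollectI exI[of _ "\<lambda>j. if j = i then 1 else 0"] conjI)
  qed
  then show ?thesis
    unfolding splitting_frame_def
    by (intro conjI ballI generates_algebra_gen gen_relations) auto
qed

definition is_splitting ::
    "(nat \<Rightarrow> 'n clifford) \<Rightarrow> ('n clifford \<Rightarrow> 'n clifford) \<Rightarrow> (nat set \<Rightarrow> complex \<Rightarrow> complex) \<Rightarrow> bool" where
  "is_splitting e f F \<longleftrightarrow>
     (\<forall>A\<in>Pow {2..CARD('n)}. F A holomorphic_on ball 0 1) \<and>
     (\<forall>z\<in>ball 0 1. f (slice_embed (e 1) z) =
        (\<Sum>A\<in>Pow {2..CARD('n)}. slice_embed (e 1) (F A z) * ordered_prod e A))"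

text \<open>
  On the disc and for \<open>A \<subseteq> {2..n}\<close> the components of a slice monogenic function are unique; other
  values of this function are arbitrary and never used.
\<close>

definition split_comp ::
    "(nat \<Rightarrow> 'n clifford) \<Rightarrow> ('n clifford \<Rightarrow> 'n clifford) \<Rightarrow> nat set \<Rightarrow> complex \<Rightarrow> complex" where
  "split_comp e f = (SOME F. is_splitting e f F)"

definition conj_refl :: "(complex \<Rightarrow> complex) \<Rightarrow> complex \<Rightarrow> complex" where
  "conj_refl G z = cnj (G (cnj z))"

definition slice_prod_restr ::
    "(nat \<Rightarrow> 'n clifford) \<Rightarrow> ('n clifford \<Rightarrow> 'n clifford) \<Rightarrow> ('n clifford \<Rightarrow> 'n clifford) \<Rightarrow>
      complex \<Rightarrow> 'n clifford" where
  "slice_prod_restr e f g z =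
     (\<Sum>C\<in>Pow {2..CARD('n)}.
        slice_embed (e 1)
          (\<Sum>(A, B) \<in> {(A, B). A \<subseteq> {2..CARD('n)} \<and> B \<subseteq> {2..CARD('n)} \<and> sym_diff A B = C}.
             (-1) ^ \<sigma> A B * split_comp e f A z *
             (if even (card A) then split_comp e g B z else conj_refl (split_comp e g B) z))
        * ordered_prod e C)"

text \<open>The extension is unique on the ball; the values outside the ball are irrelevant.\<close>

definition slice_prod ::
    "(nat \<Rightarrow> 'n clifford) \<Rightarrow> ('n clifford \<Rightarrow> 'n clifford) \<Rightarrow> ('n clifford \<Rightarrow> 'n clifford) \<Rightarrow>
      'n clifford \<Rightarrow> 'n clifford" where
  "slice_prod e f g = (SOME h. slice_monogenic_on h \<B> \<and>
     (\<forall>z\<in>ball 0 1. h (slice_embed (e 1) z) = slice_prod_restr e f g z))"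

definition slice_matrix ::
    "(nat \<Rightarrow> 'n clifford) \<Rightarrow> ('n clifford \<Rightarrow> 'n clifford) \<Rightarrow> nat set \<Rightarrow> nat set \<Rightarrow> complex \<Rightarrow> complex" where
  "slice_matrix e f A B z =
     (-1) ^ \<sigma> (sym_diff A B) B *
     (if even (card A) then split_comp e f (sym_diff A B) z
      else conj_refl (split_comp e f (sym_diff A B)) z)"

text \<open>
  Sums of \<open>N \<in> \<nat> \<union> {\<infinity>}\<close> terms, indexed from \<open>0\<close>; for \<open>N = \<infinity>\<close> the sum of the (not necessarily
  absolutely) convergent series.
\<close>

definition sums_upto :: "enat \<Rightarrow> (nat \<Rightarrow> 'a :: real_normed_vector) \<Rightarrow> 'a \<Rightarrow> bool" where
  "sums_upto N a s \<longleftrightarrow> (case N of enat k \<Rightarrow> (\<Sum>j<k. a j) = s | \<infinity> \<Rightarrow> a sums s)"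

text \<open>
  \<open>P j B C\<close> is the entry of the block column matrix in row \<open>B\<close> of block \<open>j\<close> and column \<open>C\<close>;
  it is a right inverse of the block row matrix \<open>(M_(f 0) M_(f 1) \<dots>)\<close>.  All entries are
  in \<open>H^\<infinity>\<close> of the disc.
\<close>

definition bounded_right_inverse ::
    "enat \<Rightarrow> (nat \<Rightarrow> 'n clifford) \<Rightarrow> (nat \<Rightarrow> 'n clifford \<Rightarrow> 'n clifford) \<Rightarrow>
      (nat \<Rightarrow> nat set \<Rightarrow> nat set \<Rightarrow> complex \<Rightarrow> complex) \<Rightarrow> bool" where
  "bounded_right_inverse N e f P \<longleftrightarrow>
     (\<forall>j B C. enat j < N \<and> B \<subseteq> {2..CARD('n)} \<and> C \<subseteq> {2..CARD('n)} \<longrightarrow>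
        P j B C holomorphic_on ball 0 1 \<and> bounded (P j B C ` ball 0 1)) \<and>
     (\<forall>z\<in>ball 0 1. \<forall>A C. A \<subseteq> {2..CARD('n)} \<and> C \<subseteq> {2..CARD('n)} \<longrightarrow>
        sums_upto N (\<lambda>j. \<Sum>B\<in>Pow {2..CARD('n)}. slice_matrix e (f j) A B z * P j B C z)
          (if A = C then 1 else 0))"

end

theory Submission
  imports Defs "HOL-Complex_Analysis.Complex_Analysis"
begin

text \<open>
  Write the column of \<open>P\<close> with index \<open>\<emptyset>\<close> as \<open>(P_(j,B))\<close> and let \<open>h_j\<close> be the slice monogenic function
  with components \<open>P_(j,B)\<close> for \<open>|B|\<close> even and \<open>z \<mapsto> cnj (P_(j,B) (cnj z))\<close> for \<open>|B|\<close> odd.  With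
  this reflection the component \<open>C\<close> of \<open>f_j * h_j\<close> is, up to the same reflection when \<open>|C|\<close> is odd,
  the entry \<open>C\<close> of \<open>M_(f_j) P_j\<close>, so the sum over \<open>j\<close> is the column \<open>\<emptyset>\<close> of the identity matrix,
  i.e. the constant \<open>1\<close> on the slice.  The representation formula
  \<open>h (u + v J) = ((1 - J I) h (u + v I) + (1 + J I) h (u - v I)) / 2\<close> extends this to the ball.
\<close>

section \<open>Clifford multiplication and unit vectors\<close>

text \<open>The Euclidean norm of the coefficients is not submultiplicative in general. Finite
  dimension still bounds every product by a constant \<open>K\<close> times the norms of the
  factors, and all later estimates use this \<open>K\<close>.\<close>

lemma bounded_bilinear_clifford_mult:
  "bounded_bilinear ((*) :: 'n clifford \<Rightarrow> 'n clifford \<Rightarrow> 'n clifford)"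
  unfolding bilinear_conv_bounded_bilinear[symmetric] bilinear_def
  by (auto intro!: linearI simp: algebra_simps)

lemma bounded_linear_slice_embed: "bounded_linear (slice_embed I)"
  unfolding linear_conv_bounded_linear[symmetric] slice_embed_def of_real_def
  by (rule linearI) (auto simp: algebra_simps)

lemma linear_slice_embed: "linear (slice_embed I)"
  by (simp add: bounded_linear_slice_embed linear_conv_bounded_linear)

lemma slice_embed_of_real [simp]: "slice_embed I (of_real u) = of_real u"
  by (simp add: slice_embed_def)

lemma slice_embed_simps [simp]: "slice_embed I 0 = 0" "slice_embed I 1 = 1" "slice_embed I \<i> = I"
  by (simp_all add: slice_embed_def)

lemma slice_embed_mult:
  assumes "I * I = (-1 :: 'n clifford)"
  shows "slice_embed I (z * w) = slice_embed I z * slice_embed I w"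
  by (simp add: slice_embed_def of_real_def algebra_simps assms)

text \<open>Adding the double sum for \<open>I * I\<close> to its transpose pairs
  \<open>gen i * gen j\<close> with \<open>gen j * gen i\<close>, so the defining relations remove
  everything off the diagonal.\<close>

lemma unit_vector_square:
  assumes "(I :: 'n clifford) \<in> \<S>"
  shows "I * I = -1"
proof -
  obtain x where I: "I = (\<Sum>i=1..CARD('n). x i *\<^sub>R gen i)" and x: "(\<Sum>i=1..CARD('n). (x i)\<^sup>2) = 1"
    using assms by (auto simp: unit_vectors_def)
  let ?N = "{1..CARD('n)}"
  have a: "I * I = (\<Sum>i\<in>?N. \<Sum>j\<in>?N. (x i * x j) *\<^sub>R (gen i * gen j))"
    unfolding I sum_product by (intro sum.cong refl) (simp add: mult.commute)
  have "I * I = (\<Sum>i\<in>?N. \<Sum>j\<in>?N. (x j * x i) *\<^sub>R (gen j * gen i))"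
    unfolding a by (rule sum.swap)
  then have b: "I * I = (\<Sum>i\<in>?N. \<Sum>j\<in>?N. (x i * x j) *\<^sub>R (gen j * gen i))"
    by (simp only: mult.commute[of "x _" "x _"])
  have "I * I + I * I = (\<Sum>i\<in>?N. \<Sum>j\<in>?N. (x i * x j) *\<^sub>R (gen i * gen j + gen j * gen i))"
    by (subst a, subst b) (simp add: sum.distrib scaleR_right_distrib)
  also have "\<dots> = (\<Sum>i\<in>?N. \<Sum>j\<in>?N. if j = i then (- 2 * (x i)\<^sup>2) *\<^sub>R 1 else 0)"
  proof (intro sum.cong refl)
    fix i j assume "i \<in> ?N" "j \<in> ?N"
    have "(-2 :: 'n clifford) = (-2) *\<^sub>R 1"
      by (metis of_real_def of_real_minus of_real_numeral)
    then have "gen i * gen j + gen j * gen i = (if j = i then (-2) *\<^sub>R 1 else (0 :: 'n clifford))"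
      using gen_relations[OF \<open>i \<in> ?N\<close> \<open>j \<in> ?N\<close>] by simp
    then show "(x i * x j) *\<^sub>R (gen i * gen j + gen j * gen i) =
        (if j = i then (- 2 * (x i)\<^sup>2) *\<^sub>R 1 else (0 :: 'n clifford))"
      by (cases "j = i") (simp_all add: power2_eq_square mult.commute)
  qed
  also have "\<dots> = (\<Sum>i\<in>?N. (- 2 * (x i)\<^sup>2) *\<^sub>R 1)"
    by (rule sum.cong) auto
  also have "\<dots> = (- 2 * (\<Sum>i\<in>?N. (x i)\<^sup>2)) *\<^sub>R 1"
    by (simp only: scaleR_sum_left sum_distrib_left)
  also have "\<dots> = (- 2) *\<^sub>R 1" unfolding x by simp
  finally have "2 *\<^sub>R (I * I) = 2 *\<^sub>R (- 1)" by (simp add: scaleR_2)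
  then show ?thesis by (simp only: scaleR_cancel_left) simp
qed

lemma norm_slice_embed:
  assumes "(I :: 'n clifford) \<in> \<S>"
  shows "norm (slice_embed I z) = norm z"
proof -
  obtain x where I: "I = (\<Sum>i=1..CARD('n). x i *\<^sub>R gen i)" and x: "(\<Sum>i=1..CARD('n). (x i)\<^sup>2) = 1"
    using assms by (auto simp: unit_vectors_def)
  have e: "slice_embed I z = of_real (Re z) + (\<Sum>i=1..CARD('n). (Im z * x i) *\<^sub>R gen i)"
    by (simp add: slice_embed_def I scaleR_sum_right)
  have "(norm (slice_embed I z))\<^sup>2 = (norm z)\<^sup>2"
    unfolding e norm_paravector
    by (simp add: power_mult_distrib sum_distrib_left[symmetric] x[simplified] cmod_power2)
  then show ?thesis by (metis norm_ge_zero power2_eq_iff_nonneg)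
qed

lemma norm_unit_vector: "(I :: 'n clifford) \<in> \<S> \<Longrightarrow> norm I = 1"
  using norm_slice_embed[of I \<i>] by simp

lemma coeff_unit_vector: "(I :: 'n clifford) \<in> \<S> \<Longrightarrow> coeff I {} = 0"
  by (auto simp: unit_vectors_def gen_def blade_def intro!: sum.neutral)

lemma coeff_of_real: "coeff (of_real r) A = (if A = {} then r else 0)"
  by (simp add: of_real_def coeff_one)

lemma slice_embed_para_ball:
  assumes "(I :: 'n clifford) \<in> \<S>"
  shows "slice_embed I z \<in> \<B> \<longleftrightarrow> z \<in> ball 0 1"
proof
  assume "slice_embed I z \<in> \<B>"
  then show "z \<in> ball 0 1" by (simp add: para_ball_def norm_slice_embed[OF assms])
next
  assume "z \<in> ball 0 1"
  then show "slice_embed I z \<in> \<B>" using slice_embed_disc[OF assms] by blast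
qed

text \<open>A nonreal point determines \<open>J\<close> by normalizing its vector part, whose norm
  becomes the imaginary part of \<open>z\<close>. A real point lies on every slice, and the given
  \<open>I\<close> then serves as \<open>J\<close>.\<close>

lemma para_ball_cases:
  assumes "(x :: 'n clifford) \<in> \<B>" "I \<in> (\<S> :: 'n clifford set)"
  obtains J z where "J \<in> \<S>" "Im z \<ge> 0" "z \<in> ball 0 1" "x = slice_embed J z"
proof -
  obtain y where y: "x = of_real (y 0) + (\<Sum>i=1..CARD('n). y i *\<^sub>R gen i)"
    using assms by (auto simp: para_ball_def paravectors_def)
  define r where "r = sqrt (\<Sum>i=1..CARD('n). (y i)\<^sup>2)"
  have r0: "r \<ge> 0" by (simp add: r_def sum_nonneg)
  have r2: "(\<Sum>i=1..CARD('n). (y i)\<^sup>2) = r\<^sup>2" by (simp add: r_def sum_nonneg)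
  have "\<exists>J\<in>\<S>. x = slice_embed J (Complex (y 0) r)"
  proof (cases "r = 0")
    case True
    then have "\<forall>i\<in>{1..CARD('n)}. y i = 0"
      using r2 by (simp add: sum_nonneg_eq_0_iff)
    then have "x = slice_embed I (Complex (y 0) r)"
      by (simp add: y slice_embed_def True)
    then show ?thesis using assms by blast
  next
    case False
    define J where "J = (\<Sum>i=1..CARD('n). (y i / r) *\<^sub>R gen i :: 'n clifford)"
    have "(\<Sum>i=1..CARD('n). (y i / r)\<^sup>2) = 1"
      using r2 False by (simp add: power_divide sum_divide_distrib[symmetric])
    then have "J \<in> \<S>"
      unfolding J_def unit_vectors_def by (intro CollectI exI[of _ "\<lambda>i. y i / r"] conjI refl)
    moreover have "x = slice_embed J (Complex (y 0) r)"
      using False by (simp add: y slice_embed_def J_def scaleR_sum_right)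
    ultimately show ?thesis by blast
  qed
  then obtain J where "J \<in> \<S>" "x = slice_embed J (Complex (y 0) r)" by blast
  with that[of J "Complex (y 0) r"] assms r0 show ?thesis
    by (metis complex.sel(2) slice_embed_para_ball)
qed

section \<open>Extension from a slice\<close>

text \<open>The representation formula with \<open>J\<close> and \<open>z\<close> read off the
  point: the coefficient of \<open>{}\<close> is the real part and \<open>w\<close> the vector part.
  At a real point \<open>J\<close> becomes \<open>0\<close>, which is harmless because
  \<open>z = cnj z\<close> cancels the terms with \<open>J\<close>.\<close>

definition slice_ext :: "'n clifford \<Rightarrow> (complex \<Rightarrow> 'n clifford) \<Rightarrow> 'n clifford \<Rightarrow> 'n clifford" where
  "slice_ext I G x =
     (let u = coeff x {}; w = x - of_real u; J = w /\<^sub>R norm w; z = of_real u + \<i> * of_real (norm w)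
      in (1 / 2) *\<^sub>R ((1 - J * I) * G z + (1 + J * I) * G (cnj z)))"

text \<open>The definition always selects the representative with nonnegative imaginary part. The
  formula is unchanged when \<open>(J, z)\<close> is replaced by \<open>(- J, cnj z)\<close>, and it
  does not depend on \<open>J\<close> when \<open>z\<close> is real.\<close>

lemma slice_ext_embed:
  assumes J: "(J :: 'n clifford) \<in> \<S>"
  shows "slice_ext I G (slice_embed J z) =
    (1 / 2) *\<^sub>R ((1 - J * I) * G z + (1 + J * I) * G (cnj z))"
proof -
  have u: "coeff (slice_embed J z) {} = Re z"
    by (simp add: slice_embed_def coeff_of_real coeff_unit_vector[OF J])
  have w: "slice_embed J z - of_real (Re z) = Im z *\<^sub>R J"
    by (simp add: slice_embed_def)
  have n: "norm (Im z *\<^sub>R J) = \<bar>Im z\<bar>" by (simp add: norm_unit_vector[OF J])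
  consider "Im z > 0" | "Im z < 0" | "Im z = 0" by linarith
  then show ?thesis
  proof cases
    case 1
    then have "of_real (Re z) + \<i> * of_real \<bar>Im z\<bar> = z" "(Im z *\<^sub>R J) /\<^sub>R \<bar>Im z\<bar> = J"
      by (auto simp: complex_eq_iff)
    then show ?thesis unfolding slice_ext_def u w n Let_def by simp
  next
    case 2
    then have "of_real (Re z) + \<i> * of_real \<bar>Im z\<bar> = cnj z" "(Im z *\<^sub>R J) /\<^sub>R \<bar>Im z\<bar> = - J"
      by (auto simp: complex_eq_iff)
    then show ?thesis unfolding slice_ext_def u w n Let_def by (simp add: add.commute)
  next
    case 3
    then have "of_real (Re z) + \<i> * of_real \<bar>Im z\<bar> = z" "cnj z = z"
      by (auto simp: complex_eq_iff)
    then show ?thesis unfolding slice_ext_def u w n Let_def 3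
      by (simp add: algebra_simps)
  qed
qed

text \<open>The weights \<open>1 - J * I\<close> and \<open>1 + J * I\<close> are bounded uniformly
  in \<open>J\<close>, since unit vectors have norm 1, and the disc is stable under
  conjugation.\<close>

lemma slice_ext_bounded:
  assumes I: "(I :: 'n clifford) \<in> \<S>" and G: "bounded (G ` ball 0 1)"
  shows "bounded (slice_ext I G ` \<B>)"
proof -
  interpret bounded_bilinear "(*) :: 'n clifford \<Rightarrow> _" by (rule bounded_bilinear_clifford_mult)
  obtain K where K: "K \<ge> 0" "\<And>a b :: 'n clifford. norm (a * b) \<le> norm a * norm b * K"
    using nonneg_bounded by auto
  obtain M where M: "\<And>z. z \<in> ball 0 1 \<Longrightarrow> norm (G z) \<le> M"
    using G unfolding bounded_iff by blast
  have "norm (slice_ext I G x) \<le> (norm (1 :: 'n clifford) + K) * M * K" if x: "x \<in> \<B>" for x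
  proof -
    obtain J z where J: "J \<in> \<S>" and z: "z \<in> ball 0 1" and x: "x = slice_embed J z"
      using para_ball_cases[OF x I] by metis
    have JI: "norm (J * I) \<le> K"
      using K(2)[of J I] by (simp add: norm_unit_vector I J)
    have "norm (1 - J * I) \<le> norm (1 :: 'n clifford) + K"
      "norm (1 + J * I) \<le> norm (1 :: 'n clifford) + K"
      using norm_triangle_ineq4[of 1 "J * I"] norm_triangle_ineq[of 1 "J * I"] JI by linarith+
    moreover have "norm (G z) \<le> M" "norm (G (cnj z)) \<le> M" using z by (auto intro!: M)
    ultimately have "norm ((1 - J * I) * G z) \<le> (norm (1 :: 'n clifford) + K) * M * K"
       "norm ((1 + J * I) * G (cnj z)) \<le> (norm (1 :: 'n clifford) + K) * M * K"
      using K(1) by (auto intro!: order_trans[OF K(2)] mult_right_mono mult_mono)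
    then have "norm ((1 - J * I) * G z + (1 + J * I) * G (cnj z)) \<le>
        2 * ((norm (1 :: 'n clifford) + K) * M * K)"
      by (intro order_trans[OF norm_triangle_ineq]) linarith
    then show ?thesis unfolding x slice_ext_embed[OF J] by simp
  qed
  then show ?thesis by (auto simp: bounded_iff)
qed

text \<open>
  At a real point the unit vector \<open>J\<close> jumps, but the extension of the linear map \<open>z \<mapsto> (z - u) D\<close> is
  \<open>y \<mapsto> (y - u) D\<close>, so the linear approximation of \<open>G\<close> extends with an error of the same order.
\<close>

lemma slice_ext_differentiable_real:
  assumes I: "(I :: 'n clifford) \<in> \<S>"
    and G: "(G has_derivative (\<lambda>h. slice_embed I h * D)) (at (of_real u))"
  shows "(slice_ext I G has_derivative (\<lambda>y. y * D)) (at (of_real u) within \<B>)"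
proof -
  interpret bounded_bilinear "(*) :: 'n clifford \<Rightarrow> _" by (rule bounded_bilinear_clifford_mult)
  obtain K where K: "K > 0" "\<And>a b :: 'n clifford. norm (a * b) \<le> norm a * norm b * K"
    using pos_bounded by auto
  \<comment> \<open>\<open>L\<close> bounds left multiplication by \<open>1 - J * I\<close> and by
    \<open>1 + J * I\<close> for all \<open>J\<close> at once. Tolerance
    \<open>\<epsilon> / L\<close> at both \<open>z\<close> and \<open>cnj z\<close> gives
    \<open>2 * \<epsilon>\<close>, which the factor \<open>1 / 2\<close> of the formula reduces to
    \<open>\<epsilon>\<close>.\<close>
  define L where "L = (norm (1 :: 'n clifford) + K) * K"
  have L: "L > 0" using K by (simp add: L_def add_nonneg_pos)
  show ?thesis
    unfolding has_derivative_within_alt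
  proof (intro conjI allI impI)
    show "bounded_linear (\<lambda>y. y * D)" by (rule bounded_linear_left)
    fix \<epsilon> :: real assume "\<epsilon> > 0"
    then have "\<epsilon> / L > 0" using L by simp
    then obtain d where d: "d > 0" and
      "\<And>z. norm (z - of_real u) < d \<Longrightarrow>
        norm (G z - G (of_real u) - slice_embed I (z - of_real u) * D) \<le> \<epsilon> / L * norm (z - of_real u)"
      using G unfolding has_derivative_at_alt by blast
    note * = this(2)
    define R where "R z = G z - G (of_real u) - slice_embed I (z - of_real u) * D" for z
    show "\<exists>d>0. \<forall>y\<in>\<B>. norm (y - of_real u) < d \<longrightarrow>
        norm (slice_ext I G y - slice_ext I G (of_real u) - (y - of_real u) * D) \<le>
        \<epsilon> * norm (y - of_real u)"
    proof (intro exI[of _ d] conjI ballI impI d)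
      fix y :: "'n clifford" assume y: "y \<in> \<B>" and yd: "norm (y - of_real u) < d"
      obtain J z where J: "J \<in> \<S>" and z: "z \<in> ball 0 1" and yz: "y = slice_embed J z"
        using para_ball_cases[OF y I] by metis
      have yu: "y - of_real u = slice_embed J (z - of_real u)"
        unfolding yz by (simp add: linear_diff[OF linear_slice_embed])
      then have n: "norm (y - of_real u) = norm (z - of_real u)"
        by (simp add: norm_slice_embed[OF J])
      have n': "norm (z - of_real u) = norm (cnj z - of_real u)"
        by (metis complex_cnj_complex_of_real complex_cnj_diff complex_mod_cnj)
      have R: "norm (R z) \<le> \<epsilon> / L * norm (y - of_real u)" "norm (R (cnj z)) \<le> \<epsilon> / L * norm (y - of_real u)"
        using *[of z] *[of "cnj z"] yd by (auto simp: R_def n n')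
      have JI: "norm (J * I) \<le> K"
        using K(2)[of J I] by (simp add: norm_unit_vector I J)
      have "norm (1 - J * I) \<le> norm (1 :: 'n clifford) + K"
        "norm (1 + J * I) \<le> norm (1 :: 'n clifford) + K"
        using norm_triangle_ineq4[of 1 "J * I"] norm_triangle_ineq[of 1 "J * I"] JI by linarith+
      then have "norm ((1 - J * I) * R z) \<le> (norm (1 :: 'n clifford) + K) * (\<epsilon> / L * norm (y - of_real u)) * K"
         "norm ((1 + J * I) * R (cnj z)) \<le> (norm (1 :: 'n clifford) + K) * (\<epsilon> / L * norm (y - of_real u)) * K"
        by (intro order_trans[OF K(2)] mult_right_mono mult_mono; use K(1) R in simp)+
      moreover have "(norm (1 :: 'n clifford) + K) * (\<epsilon> / L * norm (y - of_real u)) * K =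
          L * (\<epsilon> / L) * norm (y - of_real u)" by (simp add: L_def)
      moreover have "L * (\<epsilon> / L) * norm (y - of_real u) = \<epsilon> * norm (y - of_real u)"
        using L by simp
      ultimately have "norm ((1 - J * I) * R z) \<le> \<epsilon> * norm (y - of_real u)"
        "norm ((1 + J * I) * R (cnj z)) \<le> \<epsilon> * norm (y - of_real u)" by argo+
      from order_trans[OF norm_triangle_ineq add_mono[OF this]]
      have "norm ((1 - J * I) * R z + (1 + J * I) * R (cnj z)) \<le> 2 * (\<epsilon> * norm (y - of_real u))"
        by simp
      \<comment> \<open>The linear parts recombine by \<open>(1 - J * I) * (a + b * I) + (1 + J * I)
        * (a - b * I) = 2 * (a + b * J)\<close>, a consequence of \<open>I * I = -1\<close>; only
        the remainders \<open>R\<close> survive.\<close>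
      moreover have "slice_ext I G y - slice_ext I G (of_real u) - (y - of_real u) * D =
          (1 / 2) *\<^sub>R ((1 - J * I) * R z + (1 + J * I) * R (cnj z))"
      proof -
        define a b where "a = Re z - u" and "b = Im z"
        have ab: "slice_embed I' (z - of_real u) = a *\<^sub>R 1 + b *\<^sub>R I'"
          "slice_embed I' (cnj z - of_real u) = a *\<^sub>R 1 - b *\<^sub>R I'" for I' :: "'n clifford"
          by (simp_all add: slice_embed_def a_def b_def of_real_def)
        have II: "I * (I * x) = - x" for x
          by (simp add: mult.assoc[symmetric] unit_vector_square[OF I])
        have Gu: "slice_ext I G (of_real u) = G (of_real u)"
          using slice_ext_embed[OF J, of I G "of_real u"]
          by (simp add: algebra_simps flip: scaleR_2)
        show ?thesis
          unfolding Gu yu unfolding yz slice_ext_embed[OF J] R_def ab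
          by (simp add: algebra_simps II flip: scaleR_2)
      qed
      ultimately show "norm (slice_ext I G y - slice_ext I G (of_real u) - (y - of_real u) * D) \<le>
          \<epsilon> * norm (y - of_real u)" by simp
    qed
  qed
qed

text \<open>Off the real axis the vector part \<open>w\<close> is nonzero, so its norm and direction
  are differentiable, and the closed formula is built from differentiable maps on a full
  neighbourhood in the algebra.\<close>

lemma slice_ext_differentiable_nonreal:
  assumes J: "(J :: 'n clifford) \<in> \<S>" and z: "Im z > 0"
    and G: "G differentiable (at z)" "G differentiable (at (cnj z))"
  shows "slice_ext I G differentiable (at (slice_embed J z))"
proof -
  define x where "x = slice_embed J z"
  define u where "u y = coeff y {}" for y :: "'n clifford"
  define w where "w y = y - of_real (u y)" for y :: "'n clifford"
  define \<zeta> where "\<zeta> y = of_real (u y) + \<i> * of_real (norm (w y))" for y :: "'n clifford"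
  have u: "bounded_linear u"
    unfolding linear_conv_bounded_linear[symmetric] u_def by (rule linearI) auto
  have w: "bounded_linear w"
    unfolding linear_conv_bounded_linear[symmetric] w_def of_real_def u_def
    by (rule linearI) (auto simp: algebra_simps)
  have ux: "u x = Re z"
    by (simp add: x_def u_def slice_embed_def coeff_of_real coeff_unit_vector[OF J])
  have wx: "w x = Im z *\<^sub>R J"
    by (simp add: w_def ux) (simp add: x_def slice_embed_def)
  have w0: "w x \<noteq> 0" using wx z norm_unit_vector[OF J] by auto
  have \<zeta>x: "\<zeta> x = z"
    using z by (simp add: \<zeta>_def ux wx norm_unit_vector[OF J] complex_eq_iff)
  have dw: "w differentiable (at x)"
    using w bounded_linear_imp_differentiable by blast
  have dn: "(\<lambda>y. norm (w y)) differentiable (at x)"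
    using differentiable_chain_at[OF dw, of norm] differentiable_norm_at[OF w0] by (simp add: o_def)
  have du: "u differentiable (at x)"
    using u bounded_linear_imp_differentiable by blast
  have dc: "of_real differentiable (at (r :: real))" for r
    by (rule bounded_linear_imp_differentiable) (rule bounded_linear_of_real)
  have "\<zeta> differentiable (at x)"
    unfolding \<zeta>_def
    using differentiable_chain_at[OF du dc] differentiable_chain_at[OF dn dc]
    by (auto simp: o_def intro!: derivative_intros)
  then obtain \<zeta>' where \<zeta>': "(\<zeta> has_derivative \<zeta>') (at x)" unfolding differentiable_def by blast
  obtain G1 G2 where G1: "(G has_derivative G1) (at (\<zeta> x))"
    and G2: "(G has_derivative G2) (at (cnj (\<zeta> x)))"
    using G unfolding differentiable_def \<zeta>x by blast
  have d1: "((\<lambda>y. G (\<zeta> y)) has_derivative (\<lambda>h. G1 (\<zeta>' h))) (at x)"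
    using diff_chain_at[OF \<zeta>' G1] by (simp add: o_def)
  have c: "((\<lambda>y. cnj (\<zeta> y)) has_derivative (\<lambda>h. cnj (\<zeta>' h))) (at x)"
    using \<zeta>' by (rule bounded_linear.has_derivative[OF bounded_linear_cnj])
  have d2: "((\<lambda>y. G (cnj (\<zeta> y))) has_derivative (\<lambda>h. G2 (cnj (\<zeta>' h)))) (at x)"
    using diff_chain_at[OF c G2] by (simp add: o_def)
  have "(\<lambda>y. w y /\<^sub>R norm (w y)) differentiable (at x)"
    using w0 by (intro differentiable_scaleR differentiable_inverse dw dn) auto
  then obtain J' where J': "((\<lambda>y. w y /\<^sub>R norm (w y)) has_derivative J') (at x)"
    unfolding differentiable_def by blast
  have JI: "((\<lambda>y. (w y /\<^sub>R norm (w y)) * I) has_derivative (\<lambda>h. J' h * I)) (at x)"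
    by (rule bounded_linear.has_derivative[OF
          bounded_bilinear.bounded_linear_left[OF bounded_bilinear_clifford_mult] J'])
  note FD = bounded_bilinear.FDERIV[OF bounded_bilinear_clifford_mult]
  have "slice_ext I G = (\<lambda>y. (1 / 2) *\<^sub>R ((1 - (w y /\<^sub>R norm (w y)) * I) * G (\<zeta> y) +
      (1 + (w y /\<^sub>R norm (w y)) * I) * G (cnj (\<zeta> y))))"
    by (simp add: slice_ext_def Let_def \<zeta>_def w_def u_def fun_eq_iff)
  moreover note has_derivative_scaleR_right[OF has_derivative_add[OF
      FD[OF has_derivative_diff[OF has_derivative_const JI] d1]
      FD[OF has_derivative_add[OF has_derivative_const JI] d2]], of "1 / 2" 1 1]
  ultimately have "\<exists>D. (slice_ext I G has_derivative D) (at x)" by auto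
  then show ?thesis unfolding differentiable_def x_def .
qed

lemma has_vector_derivative_Complex:
  "((\<lambda>s. Complex s v) has_vector_derivative 1) (at u)"
  "((\<lambda>t. Complex u t) has_vector_derivative \<i>) (at v)"
  "((\<lambda>t. Complex u (- t)) has_vector_derivative - \<i>) (at v)"
  unfolding Complex_eq by (auto intro!: derivative_eq_intros)

lemma has_vector_derivative_compose:
  assumes "(c has_vector_derivative c') (at s)" "(g has_derivative g') (at (c s))"
  shows "((\<lambda>s. g (c s)) has_vector_derivative g' c') (at s)"
  using vector_derivative_diff_chain_within[OF assms(1) has_derivative_at_withinI[OF assms(2)]]
  by (simp add: o_def)

text \<open>The assumption on \<open>G\<close> is holomorphy for left multiplication by the complex
  line of \<open>I\<close>. It carries over to the slice of \<open>J\<close> because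
  \<open>J * (1 - J * I) * I = - (1 - J * I)\<close> and
  \<open>J * (1 + J * I) * I = 1 + J * I\<close>, while the argument \<open>cnj z\<close> moves by
  \<open>- \<i>\<close> in the direction of \<open>v\<close>.\<close>

lemma slice_monogenic_slice_ext:
  assumes I: "(I :: 'n clifford) \<in> \<S>"
    and G: "\<And>z. z \<in> ball 0 1 \<Longrightarrow> (G has_derivative (\<lambda>h. slice_embed I h * D z)) (at z)"
  shows "slice_monogenic_on (slice_ext I G) \<B>"
  unfolding slice_monogenic_on_def
proof (intro conjI ballI allI impI)
  show "openin (top_of_set paravectors) (\<B> :: 'n clifford set)"
    unfolding para_ball_def by (simp add: openin_open_Int)
  show "slice_ext I G differentiable_on \<B>"
    unfolding differentiable_on_def
  proof
    fix x :: "'n clifford" assume x: "x \<in> \<B>"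
    obtain J z where J: "J \<in> \<S>" "Im z \<ge> 0" and z: "z \<in> ball 0 1" and xz: "x = slice_embed J z"
      using para_ball_cases[OF x I] by metis
    show "slice_ext I G differentiable (at x within \<B>)"
    proof (cases "Im z = 0")
      case True
      then have zr: "z = of_real (Re z)" by (simp add: complex_eq_iff)
      then have "x = of_real (Re z)" using xz by (metis slice_embed_of_real)
      with slice_ext_differentiable_real[OF I, of G "D z" "Re z"] G[OF z] zr
      show ?thesis by (metis differentiableI)
    next
      case False
      then have "slice_ext I G differentiable (at x)"
        unfolding xz using J z
        by (intro slice_ext_differentiable_nonreal) (auto intro!: differentiableI G)
      then show ?thesis by (rule differentiable_at_withinI)
    qed
  qed
  fix J :: "'n clifford" and u v
  assume J: "J \<in> \<S>" and x: "of_real u + v *\<^sub>R J \<in> \<B>"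
  have e: "of_real s + t *\<^sub>R J = slice_embed J (Complex s t)" for s t
    by (simp add: slice_embed_def)
  have z: "Complex u v \<in> ball 0 1" using x unfolding e slice_embed_para_ball[OF J] .
  then have z': "Complex u (- v) \<in> ball 0 1" by (simp add: cmod_def)
  have f: "slice_ext I G (of_real s + t *\<^sub>R J) =
      (1 / 2) *\<^sub>R ((1 - J * I) * G (Complex s t) + (1 + J * I) * G (Complex s (- t)))" for s t
  proof -
    have "cnj (Complex s t) = Complex s (- t)" by (simp add: complex_eq_iff)
    then show ?thesis unfolding e slice_ext_embed[OF J] by simp
  qed
  note bl = bounded_linear.has_vector_derivative[OF
    bounded_bilinear.bounded_linear_right[OF bounded_bilinear_clifford_mult]]
  note cv = has_vector_derivative_compose[OF has_vector_derivative_Complex(1) G[OF z]]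
    has_vector_derivative_compose[OF has_vector_derivative_Complex(2) G[OF z]]
    has_vector_derivative_compose[OF has_vector_derivative_Complex(1) G[OF z']]
    has_vector_derivative_compose[OF has_vector_derivative_Complex(3) G[OF z']]
  note sc = bounded_linear.has_vector_derivative[OF bounded_linear_scaleR_right]
  have "((\<lambda>s. slice_ext I G (of_real s + v *\<^sub>R J)) has_vector_derivative
      (1 / 2) *\<^sub>R ((1 - J * I) * (slice_embed I 1 * D (Complex u v)) +
       (1 + J * I) * (slice_embed I 1 * D (Complex u (- v))))) (at u)"
    unfolding f by (intro sc has_vector_derivative_add bl cv)
  then have 1: "vector_derivative (\<lambda>s. slice_ext I G (of_real s + v *\<^sub>R J)) (at u) =
      (1 / 2) *\<^sub>R ((1 - J * I) * D (Complex u v) + (1 + J * I) * D (Complex u (- v)))"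
    by (simp add: vector_derivative_at)
  have "((\<lambda>t. slice_ext I G (of_real u + t *\<^sub>R J)) has_vector_derivative
      (1 / 2) *\<^sub>R ((1 - J * I) * (slice_embed I \<i> * D (Complex u v)) +
       (1 + J * I) * (slice_embed I (- \<i>) * D (Complex u (- v))))) (at v)"
    unfolding f by (intro sc has_vector_derivative_add bl cv)
  then have 2: "vector_derivative (\<lambda>t. slice_ext I G (of_real u + t *\<^sub>R J)) (at v) =
      (1 / 2) *\<^sub>R ((1 - J * I) * (I * D (Complex u v)) - (1 + J * I) * (I * D (Complex u (- v))))"
    by (simp add: vector_derivative_at linear_neg[OF linear_slice_embed])
  have II: "I * (I * x) = - x" "J * (J * x) = - x" for x
    by (simp_all add: mult.assoc[symmetric] unit_vector_square I J)
  show "(1 / 2) *\<^sub>R (vector_derivative (\<lambda>s. slice_ext I G (of_real s + v *\<^sub>R J)) (at u) +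
      J * vector_derivative (\<lambda>t. slice_ext I G (of_real u + t *\<^sub>R J)) (at v)) = 0"
    unfolding 1 2 by (simp add: algebra_simps II)
qed

section \<open>Holomorphy on slices and uniqueness of the extension\<close>

text \<open>
  Condition \<open>\<phi> (J x) = \<i> \<phi> x\<close> turns \<open>\<partial>_u + J \<partial>_v\<close> into the Cauchy-Riemann operator.
\<close>

lemma slice_monogenic_holomorphic:
  fixes \<phi> :: "'n clifford \<Rightarrow> complex"
  assumes f: "slice_monogenic_on f \<B>" and J: "J \<in> \<S>"
    and \<phi>: "linear \<phi>" "\<And>x. \<phi> (J * x) = \<i> * \<phi> x"
  shows "(\<lambda>z. \<phi> (f (slice_embed J z))) holomorphic_on ball 0 1"
  unfolding holomorphic_on_def
proof
  fix z :: complex assume z: "z \<in> ball 0 1"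
  define g where "g = f \<circ> slice_embed J"
  have "slice_embed J z \<in> \<B>" using z slice_embed_para_ball[OF J] by blast
  then obtain L where L: "(f has_derivative L) (at (slice_embed J z) within \<B>)"
    using f unfolding slice_monogenic_on_def differentiable_on_def differentiable_def by blast
  have "slice_embed J ` ball 0 1 \<subseteq> \<B>" using slice_embed_para_ball[OF J] by blast
  then have L': "(f has_derivative L) (at (slice_embed J z) within slice_embed J ` ball 0 1)"
    using L has_derivative_subset by blast
  define g' where "g' = L \<circ> slice_embed J"
  have "(g has_derivative g') (at z within ball 0 1)"
    unfolding g_def g'_def
    by (rule diff_chain_within[OF _ L'])
      (intro bounded_linear_imp_has_derivative bounded_linear_slice_embed)
  then have g': "(g has_derivative g') (at z)" using z by (simp add: at_within_open[OF z open_ball])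
  have lin: "linear g'" using g' by (rule has_derivative_linear)
  have e: "f (of_real s + t *\<^sub>R J) = g (Complex s t)" for s t
    by (simp add: slice_embed_def g_def)
  have x: "of_real (Re z) + Im z *\<^sub>R J \<in> \<B>"
    using z slice_embed_para_ball[OF J, of z] by (simp add: slice_embed_def)
  have gz: "(g has_derivative g') (at (Complex (Re z) (Im z)))" using g' by simp
  have 1: "vector_derivative (\<lambda>s. f (of_real s + Im z *\<^sub>R J)) (at (Re z)) = g' 1"
    unfolding e
    by (rule vector_derivative_at[OF
          has_vector_derivative_compose[OF has_vector_derivative_Complex(1) gz]])
  have 2: "vector_derivative (\<lambda>t. f (of_real (Re z) + t *\<^sub>R J)) (at (Im z)) = g' \<i>"
    unfolding e
    by (rule vector_derivative_at[OF
          has_vector_derivative_compose[OF has_vector_derivative_Complex(2) gz]])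
  have "(1 / 2) *\<^sub>R (vector_derivative (\<lambda>s. f (of_real s + Im z *\<^sub>R J)) (at (Re z)) +
      J * vector_derivative (\<lambda>t. f (of_real (Re z) + t *\<^sub>R J)) (at (Im z))) = 0"
    using f J x unfolding slice_monogenic_on_def by blast
  then have "g' 1 + J * g' \<i> = 0" unfolding 1 2 by simp
  then have "J * g' 1 + J * (J * g' \<i>) = 0" by (metis distrib_left mult_zero_right)
  then have i: "g' \<i> = J * g' 1"
    by (simp add: mult.assoc[symmetric] unit_vector_square[OF J])
  \<comment> \<open>\<open>g'\<close> is a priori only real linear; its value
    \<open>J * g' 1\<close> at \<open>\<i>\<close> is what makes \<open>\<phi>\<close> composed with
    it multiplication by a complex number.\<close>
  have "(\<lambda>h. \<phi> (g' h)) = (*) (\<phi> (g' 1))"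
  proof
    fix h
    have "h = Re h *\<^sub>R 1 + Im h *\<^sub>R \<i>" by (simp add: complex_eq_iff)
    then have "g' h = Re h *\<^sub>R g' 1 + Im h *\<^sub>R g' \<i>"
      using lin by (metis linear_add linear_scale)
    then have "\<phi> (g' h) = Re h *\<^sub>R \<phi> (g' 1) + Im h *\<^sub>R (\<i> * \<phi> (g' 1))"
      using \<phi> by (simp add: linear_add linear_scale i)
    then show "\<phi> (g' h) = \<phi> (g' 1) * h" by (simp add: complex_eq_iff)
  qed
  moreover have "bounded_linear \<phi>" using \<phi>(1) by (simp only: linear_conv_bounded_linear)
  note bounded_linear.has_derivative[OF this g']
  ultimately have "((\<lambda>z. \<phi> (g z)) has_field_derivative \<phi> (g' 1)) (at z)"
    unfolding has_field_derivative_def by simp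
  then show "(\<lambda>z. \<phi> (f (slice_embed J z))) field_differentiable (at z within ball 0 1)"
    unfolding g_def field_differentiable_def
    by (auto intro: has_field_derivative_at_within)
qed

text \<open>
  For fixed \<open>J\<close>, the maps \<open>y \<mapsto> y_A - \<i> (J y)_A\<close> are complex linear for the left action of \<open>J\<close> and
  separate points, so the identity theorem applies on each slice without completing \<open>J\<close> to a frame.
\<close>

lemma slice_monogenic_eqI:
  fixes f g :: "'n clifford \<Rightarrow> 'n clifford"
  assumes f: "slice_monogenic_on f \<B>" and g: "slice_monogenic_on g \<B>"
    and I: "I \<in> (\<S> :: 'n clifford set)"
    and eq: "\<And>u. \<bar>u\<bar> < 1 \<Longrightarrow> f (of_real u) = g (of_real u)"
    and x: "x \<in> \<B>"
  shows "f x = g x"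
proof -
  obtain J z where J: "J \<in> \<S>" and z: "z \<in> ball 0 1" and x: "x = slice_embed J z"
    using para_ball_cases[OF x I] by metis
  show ?thesis
  proof (rule clifford_eqI)
    fix A
    define \<phi> where "\<phi> y = Complex (coeff y A) (- coeff (J * y) A)" for y
    have \<phi>: "linear \<phi>"
      by (rule linearI) (auto simp: \<phi>_def complex_eq_iff algebra_simps)
    have \<phi>J: "\<phi> (J * y) = \<i> * \<phi> y" for y
      by (simp add: \<phi>_def complex_eq_iff mult.assoc[symmetric] unit_vector_square[OF J])
    define d where "d w = \<phi> (f (slice_embed J w)) - \<phi> (g (slice_embed J w))" for w
    have hol: "d holomorphic_on ball 0 1"
      unfolding d_def by (intro holomorphic_intros slice_monogenic_holomorphic f g J \<phi> \<phi>J)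
    have "d z = 0"
    \<comment> \<open>Every slice contains the real interval, where \<open>f\<close> and
      \<open>g\<close> agree. It accumulates at \<open>0\<close>, so \<open>d\<close> vanishes on
      the whole disc.\<close>
    proof (rule analytic_continuation[OF hol, of "of_real ` {-1<..<1}" 0])
      show "(of_real ` {-1<..<1} :: complex set) \<subseteq> ball 0 1" by auto
      show "(0 :: complex) islimpt of_real ` {-1<..<1}"
        unfolding islimpt_approachable
      proof (intro allI impI)
        fix r :: real assume "r > 0"
        then have "of_real (min (r / 2) (1 / 2)) \<in> (of_real ` {-1<..<1} :: complex set)"
          by (intro imageI) auto
        then show "\<exists>x'\<in>of_real ` {-1<..<1}. x' \<noteq> (0 :: complex) \<and> dist x' 0 < r"
          using \<open>r > 0\<close> by (intro bexI[of _ "of_real (min (r / 2) (1 / 2))"]) auto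
      qed
    qed (use z eq in \<open>auto simp: d_def\<close>)
    then show "coeff (f x) A = coeff (g x) A"
      unfolding d_def x \<phi>_def by (simp add: complex_eq_iff)
  qed
qed

section \<open>Sums of finitely or countably many terms\<close>

lemma sums_upto_cong:
  assumes "\<And>j. enat j < N \<Longrightarrow> a j = b j"
  shows "sums_upto N a s \<longleftrightarrow> sums_upto N b s"
proof (cases N)
  case (enat k)
  then have "(\<Sum>j<k. a j) = (\<Sum>j<k. b j)" using assms by (intro sum.cong) auto
  then show ?thesis by (simp add: sums_upto_def enat)
next
  case infinity
  then have "a = b" using assms by auto
  then show ?thesis by simp
qed

lemma sums_upto_linear:
  assumes "bounded_linear L" "sums_upto N a s"
  shows "sums_upto N (\<lambda>j. L (a j)) (L s)"
  using assms bounded_linear.sums[OF assms(1)]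
  by (auto simp: sums_upto_def linear_sum[OF bounded_linear.linear] split: enat.splits)

lemma sums_upto_add:
  assumes "sums_upto N a s" "sums_upto N b t"
  shows "sums_upto N (\<lambda>j. a j + b j) (s + t)"
  using assms by (auto simp: sums_upto_def sum.distrib intro: sums_add split: enat.splits)

lemma sums_upto_sum:
  assumes "\<And>i. i \<in> S \<Longrightarrow> sums_upto N (a i) (s i)"
  shows "sums_upto N (\<lambda>j. \<Sum>i\<in>S. a i j) (\<Sum>i\<in>S. s i)"
  using assms
  by (cases N) (auto simp: sums_upto_def intro!: sums_sum, subst sum.swap, auto intro!: sum.cong)

section \<open>Splitting with respect to a frame\<close>

lemma ordered_prod_insert_min:
  assumes "finite A" "\<forall>a\<in>A. b < a"
  shows "ordered_prod e (insert b A) = e b * ordered_prod e A"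
proof -
  have "b \<notin> A" using assms(2) by blast
  then have "sorted_list_of_set (insert b A) = b # sorted_list_of_set A"
    using assms by (simp add: insort_is_Cons less_imp_le)
  then show ?thesis by (simp add: ordered_prod_def)
qed

lemma ordered_prod_empty [simp]: "ordered_prod e {} = 1"
  by (simp add: ordered_prod_def)

lemma ordered_prod_singleton [simp]: "ordered_prod e {a} = e a"
  by (simp add: ordered_prod_def)

text \<open>The two cardinalities count the intersection twice. This separates the reflection
  condition on \<open>sym_diff C B\<close> in the slice product into conditions on \<open>C\<close>
  and \<open>B\<close>.\<close>

lemma even_card_sym_diff:
  assumes "finite A" "finite B"
  shows "even (card (sym_diff A B)) \<longleftrightarrow> (even (card A) \<longleftrightarrow> even (card B))"
proof -
  have "card (sym_diff A B) = card (A - B) + card (B - A)"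
    using assms by (intro card_Un_disjoint) auto
  moreover have "card A = card (A - B) + card (A \<inter> B)" "card B = card (B - A) + card (A \<inter> B)"
    using assms by (simp_all add: card_Diff_subset_Int Int_commute card_mono)
  ultimately show ?thesis by presburger
qed

lemma holomorphic_conj_refl:
  assumes "F holomorphic_on ball 0 1"
  shows "conj_refl F holomorphic_on ball 0 1"
proof -
  have "cnj ` ball 0 1 = ball 0 1"
  proof -
    have "z \<in> cnj ` ball 0 1" if "z \<in> ball 0 1" for z
      using that by (intro image_eqI[of _ _ "cnj z"]) auto
    then show ?thesis by auto
  qed
  then have "(cnj \<circ> F \<circ> cnj) holomorphic_on ball 0 1"
    using assms by (intro holomorphic_on_compose_cnj_cnj) auto
  then show ?thesis by (simp add: o_def conj_refl_def[abs_def])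
qed

lemma bounded_conj_refl:
  assumes "bounded (F ` ball 0 1)"
  shows "bounded (conj_refl F ` ball 0 1)"
proof -
  obtain M where "\<forall>z\<in>ball 0 1. norm (F z) \<le> M" using assms unfolding bounded_iff by blast
  then have "\<forall>z\<in>ball 0 1. norm (conj_refl F z) \<le> M" by (auto simp: conj_refl_def)
  then show ?thesis unfolding bounded_iff by blast
qed

lemma bounded_sum_image:
  fixes f :: "'i \<Rightarrow> 'a \<Rightarrow> 'b :: real_normed_vector"
  assumes "\<And>i. i \<in> S \<Longrightarrow> bounded (f i ` X)"
  shows "bounded ((\<lambda>x. \<Sum>i\<in>S. f i x) ` X)"
  using assms
proof (induction S rule: infinite_finite_induct)
  case (insert i S)
  then show ?case by (simp add: bounded_plus_comp)
qed (auto simp: bounded_iff)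

section \<open>The ordered products of a frame form a basis\<close>

locale splitting =
  fixes e :: "nat \<Rightarrow> 'n::finite clifford"
  assumes frame: "splitting_frame (e 1) e"
begin

declare One_nat_def [simp del]

lemma one_le_card: "1 \<le> CARD('n)"
  using zero_less_card_finite[where 'a = 'n] by linarith

lemma frame_unit: "i \<in> {1..CARD('n)} \<Longrightarrow> e i \<in> \<S>"
  using frame unfolding splitting_frame_def by blast

lemma e1: "e 1 \<in> \<S>"
  using one_le_card by (intro frame_unit) auto

lemma frame_anticommute:
  assumes "i \<in> {1..CARD('n)}" "j \<in> {1..CARD('n)}" "i \<noteq> j"
  shows "e i * e j = - (e j * e i)"
proof -
  have "e i * e j + e j * e i = 0"
    using frame assms unfolding splitting_frame_def by auto
  then show ?thesis by (simp add: eq_neg_iff_add_eq_0)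
qed

text \<open>Anticommutation moves \<open>e i\<close> to the right past the smaller factors until it
  reaches its place or meets its own copy, where the square is \<open>-1\<close>. The sign is left
  as an unspecified scalar \<open>s\<close>, since membership in a span is all that is required of
  it.\<close>

lemma frame_mult_ordered_prod:
  assumes "i \<in> {1..CARD('n)}" "finite A" "A \<subseteq> {1..CARD('n)}"
  shows "\<exists>s. e i * ordered_prod e A = s *\<^sub>R ordered_prod e (sym_diff {i} A)"
  using assms(2,3)
proof (induction A rule: finite_linorder_min_induct)
  case empty
  show ?case by (rule exI[of _ 1]) simp
next
  case (insert b A)
  have b: "b \<in> {1..CARD('n)}" "b \<notin> A" using insert by auto
  have E: "ordered_prod e (insert b A) = e b * ordered_prod e A"
    using insert by (intro ordered_prod_insert_min) auto
  consider "i < b" | "i = b" | "b < i" by linarith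
  then show ?case
  proof cases
    case 1
    then have "\<forall>a\<in>insert b A. i < a" using insert by auto
    then have "ordered_prod e (insert i (insert b A)) = e i * ordered_prod e (insert b A)"
      using insert by (intro ordered_prod_insert_min) auto
    moreover have "sym_diff {i} (insert b A) = insert i (insert b A)" using 1 insert by auto
    ultimately show ?thesis by (intro exI[of _ 1]) simp
  next
    case 2
    have "e i * ordered_prod e (insert b A) = (e i * e i) * ordered_prod e A"
      unfolding E 2 by (simp add: mult.assoc)
    also have "\<dots> = (-1) *\<^sub>R ordered_prod e A"
      by (simp add: unit_vector_square[OF frame_unit[OF assms(1)]])
    finally have "e i * ordered_prod e (insert b A) = (-1) *\<^sub>R ordered_prod e A" .
    moreover have "sym_diff {i} (insert b A) = A" using b 2 by auto
    ultimately show ?thesis by metis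
  next
    case 3
    obtain s where s: "e i * ordered_prod e A = s *\<^sub>R ordered_prod e (sym_diff {i} A)"
      using insert by auto
    have "e i * ordered_prod e (insert b A) = (e i * e b) * ordered_prod e A"
      unfolding E by (simp add: mult.assoc)
    also have "\<dots> = - (e b * (e i * ordered_prod e A))"
      using 3 by (simp add: frame_anticommute[OF assms(1) b(1)] mult.assoc)
    also have "\<dots> = (- s) *\<^sub>R (e b * ordered_prod e (sym_diff {i} A))"
      by (simp add: s)
    also have "e b * ordered_prod e (sym_diff {i} A) = ordered_prod e (insert b (sym_diff {i} A))"
      using insert 3 by (intro ordered_prod_insert_min[symmetric]) auto
    also have "insert b (sym_diff {i} A) = sym_diff {i} (insert b A)" using 3 by auto
    finally show ?thesis by blast
  qed
qed

lemma span_ordered_prod: "span (ordered_prod e ` Pow {1..CARD('n)}) = UNIV"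
  \<comment> \<open>The elements that map the span into itself by left multiplication form a subalgebra.\<close>
proof -
  define S where "S = span (ordered_prod e ` Pow {1..CARD('n)})"
  define T where "T = {x. \<forall>y\<in>S. x * y \<in> S}"
  have S: "subspace S" unfolding S_def by (rule subspace_span)
  have T: "subspace T"
    unfolding T_def subspace_def using S
    by (auto simp: algebra_simps subspace_0 subspace_add subspace_scale)
  have "e i * y \<in> S" if i: "i \<in> {1..CARD('n)}" and y: "y \<in> S" for i y
    using y unfolding S_def
  proof (induction rule: span_induct)
    case base
    show ?case
      unfolding subspace_def using S
      by (auto simp: algebra_simps subspace_0 subspace_add subspace_scale S_def[symmetric])
  next
    case (step x)
    then obtain A where A: "A \<subseteq> {1..CARD('n)}" "x = ordered_prod e A" by auto
    obtain s where "e i * x = s *\<^sub>R ordered_prod e (sym_diff {i} A)"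
      using frame_mult_ordered_prod[OF i] A finite_subset[OF A(1)] by blast
    moreover have "ordered_prod e (sym_diff {i} A) \<in> ordered_prod e ` Pow {1..CARD('n)}"
      using i A by (intro imageI) auto
    ultimately show ?case by (simp add: span_base span_scale)
  qed
  then have "e ` {1..CARD('n)} \<subseteq> T" by (auto simp: T_def)
  moreover have "1 \<in> T" "\<forall>x\<in>T. \<forall>y\<in>T. x * y \<in> T" by (auto simp: T_def mult.assoc)
  moreover have "generates_algebra (e ` {1..CARD('n)})"
    using frame unfolding splitting_frame_def by blast
  ultimately have "T = UNIV" using T unfolding generates_algebra_def by blast
  moreover have "1 \<in> S"
    unfolding S_def by (rule span_base) (metis ordered_prod_empty Pow_bottom imageI)
  ultimately have "x * 1 \<in> S" for x unfolding T_def by blast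
  then show ?thesis by (auto simp: S_def)
qed

text \<open>Dimension count: a spanning family indexed by \<open>2 ^ CARD('n)\<close> sets in a
  space of that dimension can have neither repetitions nor linear relations.\<close>

lemma inj_ordered_prod: "inj_on (ordered_prod e) (Pow {1..CARD('n)})"
  and independent_ordered_prod: "independent (ordered_prod e ` Pow {1..CARD('n)})"
proof -
  let ?B = "ordered_prod e ` Pow {1..CARD('n)}"
  have "dim (UNIV :: 'n clifford set) = 2 ^ CARD('n)" by (simp add: DIM_clifford)
  then have d: "dim (UNIV :: 'n clifford set) = card (Pow {1..CARD('n)})" by (simp add: card_Pow)
  have "dim (UNIV :: 'n clifford set) \<le> card ?B"
    by (rule dim_le_card) (auto simp: span_ordered_prod)
  moreover have "card ?B \<le> card (Pow {1..CARD('n)})" by (rule card_image_le) simp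
  ultimately have c: "card ?B = card (Pow {1..CARD('n)})" using d by linarith
  then show "inj_on (ordered_prod e) (Pow {1..CARD('n)})"
    by (intro eq_card_imp_inj_on) auto
  show "independent ?B"
    by (rule card_le_dim_spanning[of _ UNIV]) (simp_all only: c d span_ordered_prod, simp_all)
qed

lemma ordered_prod_insert_1:
  assumes "A \<subseteq> {2..CARD('n)}"
  shows "ordered_prod e (insert 1 A) = e 1 * ordered_prod e A"
  using assms by (intro ordered_prod_insert_min) (auto intro: finite_subset)

section \<open>Real and complex coordinates with respect to the frame\<close>

definition coord :: "nat set \<Rightarrow> 'n clifford \<Rightarrow> real" where
  "coord A x = representation (ordered_prod e ` Pow {1..CARD('n)}) x (ordered_prod e A)"

lemma linear_coord: "linear (coord A)"
  unfolding coord_def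
  by (rule linearI)
    (simp_all add: representation_add[OF independent_ordered_prod]
      representation_scale[OF independent_ordered_prod] span_ordered_prod)

lemma coord_ordered_prod:
  assumes "A \<subseteq> {1..CARD('n)}" "B \<subseteq> {1..CARD('n)}"
  shows "coord A (ordered_prod e B) = (if A = B then 1 else 0)"
  unfolding coord_def using assms
  by (subst representation_basis[OF independent_ordered_prod])
    (auto simp: inj_on_eq_iff[OF inj_ordered_prod])

lemma coord_expansion:
  "(\<Sum>A\<in>Pow {1..CARD('n)}. coord A x *\<^sub>R ordered_prod e A) = x"
proof -
  let ?B = "ordered_prod e ` Pow {1..CARD('n)}"
  have "(\<Sum>b\<in>?B. representation ?B x b *\<^sub>R b) = x"
    by (rule sum_representation_eq[OF independent_ordered_prod]) (auto simp: span_ordered_prod)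
  then show ?thesis
    by (subst (asm) sum.reindex[OF inj_ordered_prod]) (simp add: coord_def)
qed

text \<open>Since \<open>ordered_prod e (insert 1 A)\<close> equals
  \<open>e 1 * ordered_prod e A\<close> for \<open>A\<close> inside \<open>{2..CARD('n)}\<close>,
  these two real coordinates form one coefficient in the complex line of \<open>e 1\<close>.\<close>

definition component :: "nat set \<Rightarrow> 'n clifford \<Rightarrow> complex" where
  "component A x = Complex (coord A x) (coord (insert 1 A) x)"

lemma linear_component: "linear (component A)"
  by (rule linearI)
    (simp_all add: component_def complex_eq_iff linear_add[OF linear_coord] linear_scale[OF linear_coord])

definition combine :: "(nat set \<Rightarrow> complex) \<Rightarrow> 'n clifford" where
  "combine c = (\<Sum>A\<in>Pow {2..CARD('n)}. slice_embed (e 1) (c A) * ordered_prod e A)"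

lemma slice_embed_mult_ordered_prod:
  assumes "A \<subseteq> {2..CARD('n)}"
  shows "slice_embed (e 1) z * ordered_prod e A =
    Re z *\<^sub>R ordered_prod e A + Im z *\<^sub>R ordered_prod e (insert 1 A)"
  by (simp add: slice_embed_def of_real_def algebra_simps ordered_prod_insert_1[OF assms])

lemma component_combine:
  assumes "A \<subseteq> {2..CARD('n)}"
  shows "component A (combine c) = c A"
proof -
  have sub: "B \<subseteq> {1..CARD('n)}" "insert 1 B \<subseteq> {1..CARD('n)}" "1 \<notin> B"
    if "B \<subseteq> {2..CARD('n)}" for B
    using that one_le_card by fastforce+
  have *: "component A (slice_embed (e 1) (c B) * ordered_prod e B) = (if B = A then c A else 0)"
    if B: "B \<subseteq> {2..CARD('n)}" for B
  proof -
    have "A \<noteq> insert 1 B" "insert 1 A \<noteq> B" "insert 1 A = insert 1 B \<longleftrightarrow> B = A"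
      using sub(3)[OF B] sub(3)[OF assms] by (auto simp: insert_ident)
    then show ?thesis
      using sub[OF B] sub[OF assms]
      by (simp add: slice_embed_mult_ordered_prod[OF B] component_def complex_eq_iff coord_ordered_prod
          linear_add[OF linear_coord] linear_scale[OF linear_coord] del: insert_subset)
  qed
  have "component A (combine c) = (\<Sum>B\<in>Pow {2..CARD('n)}. if B = A then c A else 0)"
    unfolding combine_def linear_sum[OF linear_component] by (rule sum.cong) (auto simp: *)
  also have "\<dots> = c A" using assms by (subst sum.delta) auto
  finally show ?thesis .
qed

lemma combine_component: "combine (\<lambda>A. component A x) = x"
proof -
  let ?M = "Pow {2..CARD('n)}"
  have inj: "inj_on (insert 1) ?M"
  proof (rule inj_onI)
    fix A B assume "A \<in> ?M" "B \<in> ?M" and eq: "insert 1 A = insert 1 B"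
    then have "1 \<notin> A" "1 \<notin> B" by auto
    then show "A = B" using eq insert_ident by metis
  qed
  \<comment> \<open>Subsets are sorted by whether they contain \<open>1\<close>; the pair
    \<open>A\<close>, \<open>insert 1 A\<close> supplies the real and imaginary part of one
    component.\<close>
  have "{1..CARD('n)} = insert 1 {2..CARD('n)}" using one_le_card by auto
  then have P: "Pow {1..CARD('n)} = ?M \<union> insert 1 ` ?M" by (simp only: Pow_insert)
  have "x = (\<Sum>A\<in>?M. coord A x *\<^sub>R ordered_prod e A) +
      (\<Sum>A\<in>insert 1 ` ?M. coord A x *\<^sub>R ordered_prod e A)"
    by (subst coord_expansion[of x, symmetric], subst P, rule sum.union_disjoint) auto
  also have "\<dots> = combine (\<lambda>A. component A x)"
    unfolding sum.reindex[OF inj] combine_def sum.distrib[symmetric]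
    by (rule sum.cong) (simp_all add: slice_embed_mult_ordered_prod component_def)
  finally show ?thesis by simp
qed

lemma e1_mult_combine: "e 1 * combine c = combine (\<lambda>A. \<i> * c A)"
  unfolding combine_def sum_distrib_left
  by (simp add: slice_embed_mult[OF unit_vector_square[OF e1]] mult.assoc)

text \<open>This makes \<open>component A\<close> an admissible \<open>\<phi>\<close> in
  \<open>slice_monogenic_holomorphic\<close>, hence gives holomorphic components on the
  slice.\<close>

lemma component_e1_mult:
  assumes "A \<subseteq> {2..CARD('n)}"
  shows "component A (e 1 * x) = \<i> * component A x"
proof -
  have "component A (e 1 * combine (\<lambda>A. component A x)) = \<i> * component A x"
    unfolding e1_mult_combine component_combine[OF assms] ..
  then show ?thesis unfolding combine_component .
qed

section \<open>Existence and uniqueness of the splitting\<close>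

lemma is_splitting_combine:
  "is_splitting e f F \<longleftrightarrow> (\<forall>A\<in>Pow {2..CARD('n)}. F A holomorphic_on ball 0 1) \<and>
     (\<forall>z\<in>ball 0 1. f (slice_embed (e 1) z) = combine (\<lambda>A. F A z))"
  by (simp add: is_splitting_def combine_def)

text \<open>\<open>split_comp\<close> is an arbitrary choice among splittings, but on the disc the
  values of any two are coordinates of the same element in a basis.\<close>

lemma split_comp_eq:
  assumes "is_splitting e f F" "A \<subseteq> {2..CARD('n)}" "z \<in> ball 0 1"
  shows "split_comp e f A z = F A z"
proof -
  have "is_splitting e f (split_comp e f)"
    unfolding split_comp_def by (rule someI[where P = "is_splitting e f", OF assms(1)])
  then have "combine (\<lambda>A. split_comp e f A z) = combine (\<lambda>A. F A z)"
    using assms(1,3) unfolding is_splitting_combine by metis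
  then show ?thesis using component_combine[OF assms(2)] by metis
qed

text \<open>The basis coordinates of \<open>f\<close> on the slice are a splitting, so the choice
  defining \<open>split_comp\<close> has a witness and inherits holomorphy.\<close>

lemma split_comp_holomorphic:
  assumes "slice_monogenic_on f \<B>" "A \<subseteq> {2..CARD('n)}"
  shows "split_comp e f A holomorphic_on ball 0 1"
proof -
  have "is_splitting e f (\<lambda>A z. component A (f (slice_embed (e 1) z)))"
    unfolding is_splitting_combine combine_component
    by (auto intro!: slice_monogenic_holomorphic assms e1 linear_component component_e1_mult)
  then have "is_splitting e f (split_comp e f)"
    unfolding split_comp_def by (rule someI[where P = "is_splitting e f"])
  then show ?thesis using assms(2) unfolding is_splitting_def by blast
qed

section \<open>Extension of given components from the slice to the ball\<close>

definition slice_extension :: "(nat set \<Rightarrow> complex \<Rightarrow> complex) \<Rightarrow> 'n clifford \<Rightarrow> 'n clifford" where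
  "slice_extension F = slice_ext (e 1) (\<lambda>z. combine (\<lambda>A. F A z))"

lemma slice_extension_slice: "slice_extension F (slice_embed (e 1) z) = combine (\<lambda>A. F A z)"
  by (simp only: slice_extension_def slice_ext_embed[OF e1] unit_vector_square[OF e1])
    (simp add: flip: scaleR_2)

lemma slice_monogenic_slice_extension:
  assumes F: "\<And>A. A \<subseteq> {2..CARD('n)} \<Longrightarrow> F A holomorphic_on ball 0 1"
  shows "slice_monogenic_on (slice_extension F) \<B>"
  unfolding slice_extension_def
proof (rule slice_monogenic_slice_ext[OF e1])
  fix z :: complex assume z: "z \<in> ball 0 1"
  have "((\<lambda>z. slice_embed (e 1) (F A z) * ordered_prod e A) has_derivative
      (\<lambda>h. slice_embed (e 1) (deriv (F A) z * h) * ordered_prod e A)) (at z)"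
    if A: "A \<in> Pow {2..CARD('n)}" for A
  proof -
    have "(F A has_field_derivative deriv (F A) z) (at z)"
      using holomorphic_derivI[OF F open_ball z] A by simp
    then have "(F A has_derivative (\<lambda>h. deriv (F A) z * h)) (at z)"
      unfolding has_field_derivative_def .
    then show ?thesis
      by (intro bounded_linear.has_derivative[OF bounded_bilinear.bounded_linear_left[OF
              bounded_bilinear_clifford_mult]]
            bounded_linear.has_derivative[OF bounded_linear_slice_embed])
  qed
  then have "((\<lambda>z. combine (\<lambda>A. F A z)) has_derivative
      (\<lambda>h. combine (\<lambda>A. deriv (F A) z * h))) (at z)"
    unfolding combine_def by (rule has_derivative_sum)
  \<comment> \<open>The factor \<open>h\<close> commutes with the derivatives inside the complex
    line of \<open>e 1\<close>, so it can be pulled out to the far left, the form that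
    \<open>slice_monogenic_slice_ext\<close> requires.\<close>
  moreover have "combine (\<lambda>A. deriv (F A) z * h) = slice_embed (e 1) h * combine (\<lambda>A. deriv (F A) z)" for h
    unfolding combine_def sum_distrib_left mult.commute[of _ h]
    by (simp only: slice_embed_mult[OF unit_vector_square[OF e1]] mult.assoc)
  ultimately show "((\<lambda>z. combine (\<lambda>A. F A z)) has_derivative
      (\<lambda>h. slice_embed (e 1) h * combine (\<lambda>A. deriv (F A) z))) (at z)" by simp
qed

lemma bounded_slice_extension:
  assumes F: "\<And>A. A \<subseteq> {2..CARD('n)} \<Longrightarrow> bounded (F A ` ball 0 1)"
  shows "bounded (slice_extension F ` \<B>)"
  unfolding slice_extension_def
proof (rule slice_ext_bounded[OF e1])
  have "bounded ((\<lambda>z. slice_embed (e 1) (F A z) * ordered_prod e A) ` ball 0 1)"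
    if A: "A \<in> Pow {2..CARD('n)}" for A
    using bounded_linear_image[OF bounded_linear_image[OF F bounded_linear_slice_embed]
        bounded_bilinear.bounded_linear_left[OF bounded_bilinear_clifford_mult]] A
    by (simp add: image_image)
  then show "bounded ((\<lambda>z. combine (\<lambda>A. F A z)) ` ball 0 1)"
    unfolding combine_def by (rule bounded_sum_image)
qed

lemma split_comp_slice_extension:
  assumes "\<And>A. A \<subseteq> {2..CARD('n)} \<Longrightarrow> F A holomorphic_on ball 0 1"
    and "A \<subseteq> {2..CARD('n)}" "z \<in> ball 0 1"
  shows "split_comp e (slice_extension F) A z = F A z"
  using assms by (intro split_comp_eq) (auto simp: is_splitting_combine slice_extension_slice)

section \<open>Components of the slice product\<close>

definition prod_comp ::
    "('n clifford \<Rightarrow> 'n clifford) \<Rightarrow> ('n clifford \<Rightarrow> 'n clifford) \<Rightarrow> nat set \<Rightarrow> complex \<Rightarrow> complex" where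
  "prod_comp f g C z = (\<Sum>B\<in>Pow {2..CARD('n)}. (-1) ^ \<sigma> (sym_diff C B) B *
     split_comp e f (sym_diff C B) z *
     (if even (card (sym_diff C B)) then split_comp e g B z else conj_refl (split_comp e g B) z))"

text \<open>For fixed \<open>C\<close> the index \<open>B\<close> determines
  \<open>A = sym_diff C B\<close>. Summing over \<open>B\<close> alone brings component
  \<open>C\<close> into the shape of row \<open>C\<close> of the matrix of \<open>f\<close>.\<close>

lemma slice_prod_restr_eq: "slice_prod_restr e f g z = combine (\<lambda>C. prod_comp f g C z)"
  unfolding slice_prod_restr_def combine_def
proof (intro sum.cong refl arg_cong2[of _ _ _ _ "(*)"] arg_cong[of _ _ "slice_embed (e 1)"])
  fix C assume C: "C \<in> Pow {2..CARD('n)}"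
  show "(\<Sum>(A, B) \<in> {(A, B). A \<subseteq> {2..CARD('n)} \<and> B \<subseteq> {2..CARD('n)} \<and> sym_diff A B = C}.
             (-1) ^ \<sigma> A B * split_comp e f A z *
             (if even (card A) then split_comp e g B z else conj_refl (split_comp e g B) z)) =
        prod_comp f g C z"
    unfolding prod_comp_def
  proof (rule sum.reindex_bij_witness[of _ "\<lambda>B. (sym_diff C B, B)" snd])
    have *: "sym_diff (sym_diff A B) B = A" for A B :: "nat set" by blast
    fix p assume "p \<in> {(A, B). A \<subseteq> {2..CARD('n)} \<and> B \<subseteq> {2..CARD('n)} \<and> sym_diff A B = C}"
    then obtain A B where p: "p = (A, B)" "B \<in> Pow {2..CARD('n)}" "C = sym_diff A B" by blast
    show "(sym_diff C (snd p), snd p) = p" "snd p \<in> Pow {2..CARD('n)}"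
      unfolding p(1,3) fst_conv snd_conv * using p(2) by auto
    show "(-1) ^ \<sigma> (sym_diff C (snd p)) (snd p) * split_comp e f (sym_diff C (snd p)) z *
       (if even (card (sym_diff C (snd p))) then split_comp e g (snd p) z
        else conj_refl (split_comp e g (snd p)) z) =
      (case p of (A, B) \<Rightarrow> (-1) ^ \<sigma> A B * split_comp e f A z *
       (if even (card A) then split_comp e g B z else conj_refl (split_comp e g B) z))"
      unfolding p(1,3) fst_conv snd_conv * by simp
  qed (use C in auto)
qed

lemma prod_comp_holomorphic:
  assumes f: "slice_monogenic_on f \<B>" and g: "slice_monogenic_on g \<B>" and C: "C \<subseteq> {2..CARD('n)}"
  shows "prod_comp f g C holomorphic_on ball 0 1"
  unfolding prod_comp_def
proof (rule holomorphic_on_sum)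
  fix B assume B: "B \<in> Pow {2..CARD('n)}"
  have CB: "sym_diff C B \<subseteq> {2..CARD('n)}" using B C by auto
  note 1 = split_comp_holomorphic[OF f CB]
  have 2: "split_comp e g B holomorphic_on ball 0 1" using B by (intro split_comp_holomorphic g) auto
  note 3 = holomorphic_conj_refl[OF 2]
  show "(\<lambda>z. (-1) ^ \<sigma> (sym_diff C B) B * split_comp e f (sym_diff C B) z *
     (if even (card (sym_diff C B)) then split_comp e g B z else conj_refl (split_comp e g B) z))
     holomorphic_on ball 0 1"
    by (cases "even (card (sym_diff C B))"; simp only: if_True if_False not_True_eq_False)
      (intro holomorphic_intros 1 2 3)+
qed

text \<open>The explicit extension witnesses the choice in \<open>slice_prod\<close>. Any other
  candidate agrees with it on the slice of \<open>e 1\<close>, hence at the real points, and these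
  determine a slice monogenic function on the ball.\<close>

lemma slice_prod_eq:
  assumes f: "slice_monogenic_on f \<B>" and g: "slice_monogenic_on g \<B>" and x: "x \<in> \<B>"
  shows "slice_prod e f g x = slice_extension (prod_comp f g) x"
proof -
  let ?P = "\<lambda>h. slice_monogenic_on h \<B> \<and>
     (\<forall>z\<in>ball 0 1. h (slice_embed (e 1) z) = slice_prod_restr e f g z)"
  have slice_extension: "?P (slice_extension (prod_comp f g))"
    unfolding slice_prod_restr_eq
    by (intro conjI ballI slice_extension_slice slice_monogenic_slice_extension prod_comp_holomorphic f g)
  then have "?P (slice_prod e f g)" unfolding slice_prod_def by (rule someI[where P = ?P])
  note P = conjunct1[OF this] conjunct2[OF this]
  show ?thesis
  proof (rule slice_monogenic_eqI[OF P(1) _ e1 _ x])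
    show "slice_monogenic_on (slice_extension (prod_comp f g)) \<B>" using slice_extension by blast
    fix u :: real assume "\<bar>u\<bar> < 1"
    then have u: "of_real u \<in> ball (0 :: complex) 1" by simp
    show "slice_prod e f g (of_real u) = slice_extension (prod_comp f g) (of_real u)"
      using bspec[OF P(2) u] bspec[OF conjunct2[OF slice_extension] u] by simp
  qed
qed

section \<open>The matrix action and the Bezout identity\<close>

definition row_twist :: "nat set \<Rightarrow> (complex \<Rightarrow> complex) \<Rightarrow> complex \<Rightarrow> complex" where
  "row_twist A F = (if even (card A) then F else conj_refl F)"

text \<open>
  Reflecting the odd components turns the slice product with \<open>f\<close> into the ordinary linear action
  of the matrix of \<open>f\<close>.
\<close>

lemma prod_comp_slice_extension:
  assumes G: "\<And>B. B \<subseteq> {2..CARD('n)} \<Longrightarrow> G B holomorphic_on ball 0 1"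
    and C: "C \<subseteq> {2..CARD('n)}" and z: "z \<in> ball 0 1"
  shows "prod_comp f (slice_extension (\<lambda>B. row_twist B (G B))) C z =
     row_twist C (\<lambda>z. \<Sum>B\<in>Pow {2..CARD('n)}. slice_matrix e f C B z * G B z) z"
proof -
  let ?H = "\<lambda>B. row_twist B (G B)"
  have cz: "cnj z \<in> ball 0 1" using z by simp
  have H: "?H B holomorphic_on ball 0 1" if "B \<subseteq> {2..CARD('n)}" for B
    using G[OF that] by (simp add: row_twist_def holomorphic_conj_refl)
  have fin: "finite B" if "B \<subseteq> {2..CARD('n)}" for B using that finite_subset by blast
  have "prod_comp f (slice_extension ?H) C z =
    (\<Sum>B\<in>Pow {2..CARD('n)}. row_twist C (\<lambda>z. slice_matrix e f C B z * G B z) z)"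
    unfolding prod_comp_def
  proof (rule sum.cong[OF refl])
    fix B assume "B \<in> Pow {2..CARD('n)}"
    then have B: "B \<subseteq> {2..CARD('n)}" by simp
    have s: "split_comp e (slice_extension ?H) B w = ?H B w" if "w \<in> ball 0 1" for w
      by (rule split_comp_slice_extension[OF H B that])
    have c: "conj_refl (split_comp e (slice_extension ?H) B) z = conj_refl (?H B) z"
      unfolding conj_refl_def s[OF cz] ..
    show "(-1) ^ \<sigma> (sym_diff C B) B * split_comp e f (sym_diff C B) z *
       (if even (card (sym_diff C B)) then split_comp e (slice_extension ?H) B z
        else conj_refl (split_comp e (slice_extension ?H) B) z) =
      row_twist C (\<lambda>z. slice_matrix e f C B z * G B z) z"
      \<comment> \<open>Component \<open>B\<close> is reflected once if \<open>card B\<close> is odd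
        and once more if \<open>card (sym_diff C B)\<close> is odd. Reflection is an involution, so
        in total \<open>G B\<close> is reflected exactly when \<open>card C\<close> is odd; the
        outer twist also undoes the reflection of \<open>f\<close> in an odd row of the
        matrix.\<close>
      unfolding s[OF z] c even_card_sym_diff[OF fin[OF C] fin[OF B]]
      by (auto simp: row_twist_def conj_refl_def slice_matrix_def)
  qed
  also have "\<dots> = row_twist C (\<lambda>z. \<Sum>B\<in>Pow {2..CARD('n)}. slice_matrix e f C B z * G B z) z"
    by (simp add: row_twist_def conj_refl_def)
  finally show ?thesis .
qed

lemma bezout_solution:
  assumes "\<And>j. enat j < N \<Longrightarrow> slice_monogenic_on (f j) \<B>"
    and "\<exists>P. bounded_right_inverse N e f P"
  shows "\<exists>h :: nat \<Rightarrow> 'n clifford \<Rightarrow> 'n clifford.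
      (\<forall>j. enat j < N \<longrightarrow> slice_monogenic_on (h j) \<B> \<and> bounded (h j ` \<B>)) \<and>
      (\<forall>x\<in>\<B>. sums_upto N (\<lambda>j. slice_prod e (f j) (h j) x) 1)"
proof -
  let ?M = "Pow {2..CARD('n)}"
  obtain P where P: "bounded_right_inverse N e f P" using assms(2) by blast
  have hol: "P j B {} holomorphic_on ball 0 1" and bdd: "bounded (P j B {} ` ball 0 1)"
    if "enat j < N" "B \<subseteq> {2..CARD('n)}" for j B
    using P that unfolding bounded_right_inverse_def by auto
  have inv: "sums_upto N (\<lambda>j. \<Sum>B\<in>?M. slice_matrix e (f j) C B z * P j B {} z)
      (if C = {} then 1 else 0)" if "z \<in> ball 0 1" "C \<subseteq> {2..CARD('n)}" for z C
    using conjunct2[OF P[unfolded bounded_right_inverse_def], rule_format, of z C "{}"] that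
    by simp
  define h where "h j = slice_extension (\<lambda>B. row_twist B (P j B {}))" for j
  have h: "slice_monogenic_on (h j) \<B>" "bounded (h j ` \<B>)" if "enat j < N" for j
    unfolding h_def using hol[OF that] bdd[OF that]
    by (auto intro!: slice_monogenic_slice_extension bounded_slice_extension
        simp: row_twist_def holomorphic_conj_refl bounded_conj_refl)
  have slice: "sums_upto N (\<lambda>j. combine (\<lambda>C. prod_comp (f j) (h j) C z)) 1"
    if z: "z \<in> ball 0 1" for z
  proof -
    have "sums_upto N (\<lambda>j. prod_comp (f j) (h j) C z) (if C = {} then 1 else 0)"
      if C: "C \<subseteq> {2..CARD('n)}" for C
    proof -
      let ?R = "\<lambda>j z. \<Sum>B\<in>?M. slice_matrix e (f j) C B z * P j B {} z"
      have cz: "cnj z \<in> ball 0 1" using z by simp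
      \<comment> \<open>For odd \<open>card C\<close> the matrix identity is used at
        \<open>cnj z\<close> and then conjugated; the entries \<open>0\<close> and \<open>1\<close>
        of the identity matrix are unchanged.\<close>
      have "sums_upto N (\<lambda>j. row_twist C (?R j) z) (if C = {} then 1 else 0)"
        using inv[OF z C] sums_upto_linear[OF bounded_linear_cnj inv[OF cz C]]
        unfolding row_twist_def conj_refl_def by (cases "C = {}"; cases "even (card C)") simp_all
      then show ?thesis
        using prod_comp_slice_extension[of "\<lambda>B. P _ B {}", OF hol C z]
        by (subst sums_upto_cong) (auto simp: h_def)
    qed
    then have "sums_upto N (\<lambda>j. combine (\<lambda>C. prod_comp (f j) (h j) C z))
        (combine (\<lambda>C. if C = {} then 1 else 0))"
      unfolding combine_def
      by (intro sums_upto_sum sums_upto_linear[OF bounded_bilinear.bounded_linear_left[OF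
              bounded_bilinear_clifford_mult]] sums_upto_linear[OF bounded_linear_slice_embed]) auto
    also have "combine (\<lambda>C. if C = {} then 1 else 0) = (\<Sum>C\<in>?M. if C = {} then 1 else 0)"
      unfolding combine_def by (rule sum.cong) auto
    also have "\<dots> = 1" by (subst sum.delta) auto
    finally show ?thesis .
  qed
  have "sums_upto N (\<lambda>j. slice_prod e (f j) (h j) x) 1" if x: "x \<in> \<B>" for x
  proof -
    obtain J z where J: "J \<in> \<S>" and z: "z \<in> ball 0 1" and xz: "x = slice_embed J z"
      using para_ball_cases[OF x e1] by metis
    have cz: "cnj z \<in> ball 0 1" using z by simp
    note mult = sums_upto_linear[OF bounded_bilinear.bounded_linear_right[OF
          bounded_bilinear_clifford_mult]]
    \<comment> \<open>Off the slice each summand combines its values at \<open>z\<close> and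
      \<open>cnj z\<close> with weights independent of \<open>j\<close>, so pointwise convergence on
      the slice of \<open>e 1\<close> passes to \<open>x\<close>. The weights add up to
      \<open>2\<close>, which gives the limit \<open>1\<close>.\<close>
    have "sums_upto N (\<lambda>j. slice_extension (prod_comp (f j) (h j)) x)
        ((1 / 2) *\<^sub>R ((1 - J * e 1) * 1 + (1 + J * e 1) * 1))"
      unfolding slice_extension_def xz slice_ext_embed[OF J]
      by (intro sums_upto_linear[OF bounded_linear_scaleR_right] sums_upto_add mult slice z cz)
    then have "sums_upto N (\<lambda>j. slice_extension (prod_comp (f j) (h j)) x) 1"
      by (simp flip: scaleR_2)
    then show ?thesis
      using assms(1) h(1) x by (subst sums_upto_cong) (auto intro!: slice_prod_eq)
  qed
  then show ?thesis using h by blast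
qed

end

theorem theorem6p5:
  fixes N :: enat
    and f :: "nat \<Rightarrow> 'n::finite clifford \<Rightarrow> 'n clifford"
    and I :: "'n clifford"
    and e :: "nat \<Rightarrow> 'n clifford"
  assumes "CARD('n) \<ge> 2"
    and "\<And>j. enat j < N \<Longrightarrow> slice_monogenic_on (f j) \<B> \<and> bounded (f j ` \<B>)"
    and "I \<in> \<S>"
    and "splitting_frame I e"
    and "\<exists>P. bounded_right_inverse N e f P"
  shows "\<exists>h :: nat \<Rightarrow> 'n clifford \<Rightarrow> 'n clifford.
      (\<forall>j. enat j < N \<longrightarrow> slice_monogenic_on (h j) \<B> \<and> bounded (h j ` \<B>)) \<and>
      (\<forall>x\<in>\<B>. sums_upto N (\<lambda>j. slice_prod e (f j) (h j) x) 1)"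
proof -
  have "e 1 = I" using assms(4) by (simp add: splitting_frame_def)
  then have "splitting e" using assms(4) by (simp add: splitting_def)
  then show ?thesis using assms(2,5) by (intro splitting.bezout_solution) blast+
qed

end
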